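(* Let $\Sigma$ be a properly immersed minimal surface in $\mathrm{Nil}_3$. Assume that $\Sigma$ is contained on one side of a vertical plane $P$. Then $\Sigma$ is a vertical plane parallel to $P$.
   Context: $\mathrm{Nil}_3$ is $\mathbb{R}^3$ with coordinates $(x_1,x_2,x_3)$ and the Riemannian metric $dx_1^2+dx_2^2+\big(dx_3+\tfrac12(x_2\,dx_1-x_1\,dx_2)\big)^2$ (the Heisenberg group with a left-invariant metric). Let $\pi(x_1,x_2,x_3)=(x_1,x_2)$. A vertical plane is a surface of equation $a_1x_1+a_2x_2=b$ with $(a_1,a_2)\neq(0,0)$. Two vertical planes are parallel if their images under $\pi$ are parallel straight lines in $\mathbb{R}^2$. "On one side of $P$" means in one of the two closed half-spaces bounded by $P$. *)

theory Defs
  imports "HOL-Analysis.Analysis"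
begin

definition nil_theta :: "real^3 \<Rightarrow> real^3 \<Rightarrow> real" where
  "nil_theta x v = v$3 + (x$2 * v$1 - x$1 * v$2) / 2"

definition nil_metric :: "real^3 \<Rightarrow> real^3 \<Rightarrow> real^3 \<Rightarrow> real" where
  "nil_metric x v w = v$1 * w$1 + v$2 * w$2 + nil_theta x v * nil_theta x w"

definition nil_G :: "real^3 \<Rightarrow> real^3^3" where
  "nil_G x = (\<chi> i j. nil_metric x (axis i 1) (axis j 1))"

definition nil_dG :: "real^3 \<Rightarrow> 3 \<Rightarrow> 3 \<Rightarrow> 3 \<Rightarrow> real" where
  "nil_dG x c a b = deriv (\<lambda>t. nil_G (x + t *\<^sub>R axis c 1) $ a $ b) 0"

definition nil_Gamma :: "real^3 \<Rightarrow> 3 \<Rightarrow> 3 \<Rightarrow> 3 \<Rightarrow> real" where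
  "nil_Gamma x k i j = (1/2) * (\<Sum>l\<in>UNIV. matrix_inv (nil_G x) $ k $ l *
       (nil_dG x i j l + nil_dG x j i l - nil_dG x l i j))"

text \<open>The bilinear term Gamma(x)(v,w) with components sum_ij Gamma^k_ij v_i w_j, so that the
  covariant derivative of a vector field W along a curve with velocity V is W' + Gamma(V,W).\<close>
definition nil_Gamma_vec :: "real^3 \<Rightarrow> real^3 \<Rightarrow> real^3 \<Rightarrow> real^3" where
  "nil_Gamma_vec x v w = (\<chi> k. \<Sum>i\<in>UNIV. \<Sum>j\<in>UNIV. nil_Gamma x k i j * v$i * w$j)"

definition pder :: "2 \<Rightarrow> (real^2 \<Rightarrow> real^3) \<Rightarrow> real^2 \<Rightarrow> real^3" where
  "pder i F p = vector_derivative (\<lambda>t. F (p + t *\<^sub>R axis i 1)) (at 0)"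

definition has_pder :: "2 \<Rightarrow> (real^2 \<Rightarrow> real^3) \<Rightarrow> real^2 \<Rightarrow> bool" where
  "has_pder i F p \<longleftrightarrow> (\<lambda>t. F (p + t *\<^sub>R axis i 1)) differentiable (at 0)"

definition C2_on :: "(real^2) set \<Rightarrow> (real^2 \<Rightarrow> real^3) \<Rightarrow> bool" where
  "C2_on U X \<longleftrightarrow> open U \<and> continuous_on U X \<and>
     (\<forall>i. \<forall>p\<in>U. has_pder i X p) \<and> (\<forall>i. continuous_on U (pder i X)) \<and>
     (\<forall>i j. \<forall>p\<in>U. has_pder j (pder i X) p) \<and> (\<forall>i j. continuous_on U (pder j (pder i X)))"

definition is_immersion_on :: "(real^2) set \<Rightarrow> (real^2 \<Rightarrow> real^3) \<Rightarrow> bool" where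
  "is_immersion_on U X \<longleftrightarrow> C2_on U X \<and>
     (\<forall>p\<in>U. independent {pder 1 X p, pder 2 X p} \<and> pder 1 X p \<noteq> pder 2 X p)"

definition first_ff :: "(real^2 \<Rightarrow> real^3) \<Rightarrow> real^2 \<Rightarrow> real^2^2" where
  "first_ff X p = (\<chi> a b. nil_metric (X p) (pder a X p) (pder b X p))"

text \<open>The vector g^ab (nabla_{X_a} X_b); its normal component is (twice) the mean curvature vector.\<close>
definition trace_hessian :: "(real^2 \<Rightarrow> real^3) \<Rightarrow> real^2 \<Rightarrow> real^3" where
  "trace_hessian X p = (\<Sum>a\<in>UNIV. \<Sum>b\<in>UNIV. matrix_inv (first_ff X p) $ a $ b *\<^sub>R
       (pder b (pder a X) p + nil_Gamma_vec (X p) (pder a X p) (pder b X p)))"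

text \<open>Minimal = mean curvature vector vanishes, i.e. g^ab nabla_{X_a} X_b is tangent.\<close>
definition minimal_on :: "(real^2) set \<Rightarrow> (real^2 \<Rightarrow> real^3) \<Rightarrow> bool" where
  "minimal_on U X \<longleftrightarrow> is_immersion_on U X \<and>
     (\<forall>p\<in>U. trace_hessian X p \<in> span {pder 1 X p, pder 2 X p})"

definition properly_immersed_minimal_surface :: "'a topology \<Rightarrow> ('a \<Rightarrow> real^3) \<Rightarrow> bool" where
  "properly_immersed_minimal_surface M f \<longleftrightarrow>
     topspace M \<noteq> {} \<and> Hausdorff_space M \<and> connected_space M \<and>
     continuous_map M euclidean f \<and>
     (\<forall>K. compact K \<longrightarrow> compactin M {p \<in> topspace M. f p \<in> K}) \<and>
     (\<forall>q\<in>topspace M. \<exists>U V h. open U \<and> openin M V \<and> q \<in> V \<and>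
        homeomorphic_map (subtopology euclidean U) (subtopology M V) h \<and>
        minimal_on U (f \<circ> h))"

definition vertical_plane :: "real \<Rightarrow> real \<Rightarrow> real \<Rightarrow> (real^3) set" where
  "vertical_plane a1 a2 b = {x. a1 * x$1 + a2 * x$2 = b}"

end

theory Submission
  imports Defs
begin

text \<open>
  After a rotation about the vertical axis the surface lies in x1 \<ge> b; let c be the infimum
  of x1 on it.

  If c is attained, the first coordinate of a local parametrization solves a linear elliptic equation
  without zeroth-order term: the only non-tangential contribution, the trace of the Hessian
  of x1, is a multiple of N2 N3, and N2 is linear in the derivative of x1. By the strong minimum principle
  x1 = c holds on an open and closed set, hence everywhere; a properly immersed surface in a plane
  has open and closed image, hence fills the plane.

  If c is not attained, then x1 \<ge> c + d with d > 0 inside the tube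
  q = x2^2 + (x3 - x1 x2 / 2)^2 \<le> 1, by properness. The coordinates x2 and x3 - x1 x2 / 2
  are flat on each plane x1 = const, so log q restricted to these planes is harmonic. The level sets of
  F = x1 + k (w - w^2 / 4), w = e log q, are strictly mean-convex for small k where 0 \<le> w \<le> 1: the
  concave correction contributes -k e^2 / q (up to a factor), which beats all quadratic error terms, of order k^2 e^2 / q.
  Hence F has no interior minimum on the surface over the region 1 \<le> q \<le> exp (1/e), so F \<ge> c + 3k/4 there,
  and letting e tend to 0 gives x1 \<ge> c + 3k/4 everywhere, contradicting the choice of c.
  This replaces the family of horizontal catenoids by an explicit family of compact barriers.
\<close>

section \<open>The Levi-Civita connection and minimal immersions\<close>

lemma matrix_inv_unique:
  fixes A B :: "real^'n^'n"
  assumes "A ** B = mat 1" "B ** A = mat 1"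
  shows "matrix_inv A = B"
proof -
  have "A ** matrix_inv A = mat 1 \<and> matrix_inv A ** A = mat 1"
    unfolding matrix_inv_def by (rule someI[where x = B]) (use assms in auto)
  then show ?thesis
    by (metis assms(1) matrix_mul_assoc matrix_mul_lid matrix_mul_rid)
qed

text \<open>The third entry makes the result annihilated by the contact form at x.\<close>
definition nil_conn :: "real^3 \<Rightarrow> real^3 \<Rightarrow> real^3 \<Rightarrow> real^3" where
  "nil_conn x v w =
    (let h1 = (nil_theta x w * v$2 + nil_theta x v * w$2) / 2;
         h2 = - (nil_theta x w * v$1 + nil_theta x v * w$1) / 2
     in vector [h1, h2, - (x$2 * h1 - x$1 * h2) / 2])"

lemma nil_G_eq:
  "nil_G x = vector [vector [1 + (x$2)\<^sup>2 / 4, - x$1 * x$2 / 4, x$2 / 2],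
                     vector [- x$1 * x$2 / 4, 1 + (x$1)\<^sup>2 / 4, - x$1 / 2],
                     vector [x$2 / 2, - x$1 / 2, 1]]"
  by (simp add: nil_G_def vec_eq_iff forall_3 nil_metric_def nil_theta_def axis_def power2_eq_square)

lemma matrix_inv_nil_G:
  "matrix_inv (nil_G x) =
     vector [vector [1, 0, - x$2 / 2],
             vector [0, 1, x$1 / 2],
             vector [- x$2 / 2, x$1 / 2, 1 + ((x$1)\<^sup>2 + (x$2)\<^sup>2) / 4]]"
  by (rule matrix_inv_unique)
    (simp_all add: nil_G_eq vec_eq_iff forall_3 matrix_matrix_mult_def sum_3 mat_def field_simps power2_eq_square)

text \<open>The block for \<open>c = 3\<close> is zero because the metric is invariant under
  vertical translations.\<close>

lemma nil_dG_eq: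
  "nil_dG x c a b =
    (vector [vector [vector [0, - x$2 / 4, 0], vector [- x$2 / 4, x$1 / 2, - 1/2], vector [0, - 1/2, 0]],
            vector [vector [x$2 / 2, - x$1 / 4, 1/2], vector [- x$1 / 4, 0, 0], vector [1/2, 0, 0]],
            0] :: real^3^3^3) $ c $ a $ b"
proof -
  have *: "((\<lambda>t. nil_G (x + t *\<^sub>R axis c 1) $ a $ b) has_real_derivative
    (vector [vector [vector [0, - x$2 / 4, 0], vector [- x$2 / 4, x$1 / 2, - 1/2], vector [0, - 1/2, 0]],
            vector [vector [x$2 / 2, - x$1 / 4, 1/2], vector [- x$1 / 4, 0, 0], vector [1/2, 0, 0]],
            0] :: real^3^3^3) $ c $ a $ b) (at 0)"
    using exhaust_3[of a] exhaust_3[of b] exhaust_3[of c]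
    by (elim disjE; simp add: nil_G_eq axis_def; (auto intro!: derivative_eq_intros simp: field_simps)?)
  show ?thesis unfolding nil_dG_def by (rule DERIV_imp_deriv[OF *])
qed

text \<open>This removes the inverse metric and the coordinate derivatives of the metric: all later
  computations use the formula \<open>nil_conn\<close>, in which the velocities enter only through
  their horizontal components and the contact form.\<close>

lemma nil_Gamma_vec_eq: "nil_Gamma_vec x v w = nil_conn x v w"
  unfolding vec_eq_iff forall_3 nil_Gamma_vec_def nil_Gamma_def nil_dG_eq matrix_inv_nil_G
    nil_conn_def nil_theta_def Let_def
  by (simp add: sum_3; simp add: field_simps power2_eq_square)

lemma det_first_ff_eq:
  fixes X p
  defines "E \<equiv> first_ff X p $ 1 $ 1" and "F \<equiv> first_ff X p $ 1 $ 2" and "G \<equiv> first_ff X p $ 2 $ 2"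
  assumes "E * G - F * F \<noteq> 0"
  shows "(E * G - F * F) *\<^sub>R trace_hessian X p =
    G *\<^sub>R (pder 1 (pder 1 X) p + nil_conn (X p) (pder 1 X p) (pder 1 X p))
    - F *\<^sub>R (pder 2 (pder 1 X) p + nil_conn (X p) (pder 1 X p) (pder 2 X p))
    - F *\<^sub>R (pder 1 (pder 2 X) p + nil_conn (X p) (pder 2 X p) (pder 1 X p))
    + E *\<^sub>R (pder 2 (pder 2 X) p + nil_conn (X p) (pder 2 X p) (pder 2 X p))"
proof -
  have sym: "first_ff X p $ 2 $ 1 = F"
    by (simp add: F_def first_ff_def nil_metric_def mult.commute)
  define D where "D = E * G - F * F"
  have "D \<noteq> 0" using assms(4) by (simp add: D_def)
  \<comment> \<open>The cofactor formula; the factor \<open>1 / D\<close> cancels against the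
    determinant on the left of the claim.\<close>
  then have "matrix_inv (first_ff X p) = vector [vector [G / D, - F / D], vector [- F / D, E / D]]"
    by (intro matrix_inv_unique)
      (simp_all add: vec_eq_iff forall_2 matrix_matrix_mult_def sum_2 mat_def sym E_def[symmetric]
        F_def[symmetric] G_def[symmetric] field_simps, simp_all add: D_def algebra_simps)
  with \<open>D \<noteq> 0\<close> show ?thesis
    by (simp add: trace_hessian_def sum_2 nil_Gamma_vec_eq scaleR_add_right scaleR_diff_right D_def[symmetric])
qed

section \<open>From partial derivatives to jets of minimal immersions\<close>

text \<open>Continuous partial derivatives give Frechet differentiability. The criterion
  \<open>has_derivative_partialsI\<close> lives on a product type, so the plane is identified with
  pairs through \<open>v\<close>.\<close>

lemma has_derivative_pder:
  fixes F :: "real^2 \<Rightarrow> real^3"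
  assumes U: "open U" "p \<in> U" and d: "\<And>i q. q \<in> U \<Longrightarrow> has_pder i F q"
    and c: "\<And>i. continuous_on U (pder i F)"
  shows "(F has_derivative (\<lambda>h. \<Sum>a\<in>UNIV. h$a *\<^sub>R pder a F p)) (at p)"
proof -
  define v :: "real \<Rightarrow> real \<Rightarrow> real^2" where "v = (\<lambda>a b. vector [a, b])"
  define f where "f = (\<lambda>a b. F (v a b))"
  have vshift: "v a b + t *\<^sub>R axis 1 1 = v (a + t) b" "v a b + t *\<^sub>R axis 2 1 = v a (b + t)" for a b t
    by (simp_all add: v_def vec_eq_iff forall_2 axis_def)
  have vd: "((\<lambda>(a, b). v a b) has_derivative (\<lambda>(a, b). v a b)) F'" for F'
  proof -
    have "bounded_linear (\<lambda>(a, b). v a b)"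
      unfolding linear_conv_bounded_linear[symmetric]
      by (rule linearI) (auto simp: v_def vec_eq_iff forall_2)
    then show ?thesis by (rule bounded_linear_imp_has_derivative)
  qed
  have vc: "continuous_on S (\<lambda>(a, b). v a b)" for S
    by (rule has_derivative_continuous_on) (rule vd)
  have D: "((\<lambda>s. F (q + s *\<^sub>R axis i 1)) has_derivative (\<lambda>s. s *\<^sub>R pder i F q)) (at 0)" if "q \<in> U" for i q
    using d[OF that, of i] unfolding has_pder_def vector_derivative_works has_vector_derivative_def pder_def .
  have shift: "((\<lambda>s. g s) has_derivative g') (at a)" if "((\<lambda>s. g (a + s)) has_derivative g') (at 0)"
    for g :: "real \<Rightarrow> real^3" and g' a
  proof -
    have "((\<lambda>s. g (a + (s - a))) has_derivative (\<lambda>s. g' s)) (at a)"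
      by (rule has_derivative_compose[where f = "\<lambda>s. s - a", of "\<lambda>s. s" a UNIV "\<lambda>s. g (a + s)" g'])
        (use that in \<open>auto intro!: derivative_eq_intros\<close>)
    then show ?thesis by simp
  qed
  have fx: "((\<lambda>a. f a b) has_derivative (\<lambda>s. s *\<^sub>R pder 1 F (v a b))) (at a)" if "v a b \<in> U" for a b
    using D[OF that, of 1] unfolding f_def vshift by (rule shift)
  have fy: "((\<lambda>b. f a b) has_derivative (\<lambda>s. s *\<^sub>R pder 2 F (v a b))) (at b)" if "v a b \<in> U" for a b
    using D[OF that, of 2] unfolding f_def vshift by (rule shift)
  define x y where "x = p$1" and "y = p$2"
  have p: "p = v x y" by (simp add: v_def x_def y_def vec_eq_iff forall_2)
  have "open ((\<lambda>(a, b). v a b) -` U)" by (rule open_vimage[OF U(1) vc])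
  moreover have "(x, y) \<in> (\<lambda>(a, b). v a b) -` U" using U p by simp
  ultimately obtain A B where AB: "open A" "open B" "x \<in> A" "y \<in> B" "A \<times> B \<subseteq> (\<lambda>(a, b). v a b) -` U"
    by (elim open_prod_elim[of _ "(x, y)"]) auto
  \<comment> \<open>The second factor of the neighbourhood has to be convex, hence a ball instead of
    \<open>B\<close>.\<close>
  obtain e where e: "e > 0" "ball y e \<subseteq> B" using AB open_contains_ball by blast
  have inU: "v a b \<in> U" if "a \<in> A" "b \<in> ball y e" for a b
  proof -
    have "(a, b) \<in> A \<times> B" using that e by auto
    then show ?thesis using AB by auto
  qed
  have bl: "bounded_linear (\<lambda>s::real. s *\<^sub>R w)" for w :: "real^3"
    by (rule bounded_linear_scaleR_left)
  define fy' where "fy' = (\<lambda>a b. blinfun_scaleR_left (pder 2 F (v a b)))"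
  have *: "((\<lambda>(a, b). f a b) has_derivative (\<lambda>(tx, ty). tx *\<^sub>R pder 1 F (v x y) + blinfun_apply (fy' x y) ty))
      (at (x, y) within A \<times> ball y e)"
  proof (rule has_derivative_partialsI)
    show "((\<lambda>a. f a y) has_derivative (\<lambda>s. s *\<^sub>R pder 1 F (v x y))) (at x within A)"
      using fx[of x y] inU[of x y] AB e by (auto intro: has_derivative_at_withinI)
    show "((\<lambda>b. f a b) has_derivative blinfun_apply (fy' a b)) (at b within ball y e)"
      if "a \<in> A" "b \<in> ball y e" for a b
      using fy[of a b] inU[OF that] by (auto simp: fy'_def blinfun_scaleR_left.rep_eq intro: has_derivative_at_withinI)
    have "continuous_on (A \<times> ball y e) (\<lambda>z. pder 2 F ((\<lambda>(a, b). v a b) z))"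
      by (rule continuous_on_compose2[OF c vc]) (use inU in auto)
    then have "continuous_on (A \<times> ball y e) (\<lambda>(a, b). fy' a b)"
      unfolding fy'_def case_prod_beta
      by (intro bounded_linear.continuous_on[OF bounded_linear_blinfun_scaleR_left])
    then show "continuous (at (x, y) within A \<times> ball y e) (\<lambda>(a, b). fy' a b)"
      using AB e by (auto simp: continuous_on_eq_continuous_within)
  qed (use e in auto)
  have op: "open (A \<times> ball y e)" "(x, y) \<in> A \<times> ball y e" using AB e by (auto intro: open_Times)
  have **: "((\<lambda>(a, b). f a b) has_derivative (\<lambda>(tx, ty). tx *\<^sub>R pder 1 F p + ty *\<^sub>R pder 2 F p)) (at (x, y))"
    using * at_within_open[OF op(2) op(1)] by (simp add: fy'_def blinfun_scaleR_left.rep_eq p)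
  have "((\<lambda>q. (\<lambda>(a, b). f a b) (q$1, q$2)) has_derivative (\<lambda>h. (\<lambda>(tx, ty). tx *\<^sub>R pder 1 F p + ty *\<^sub>R pder 2 F p) (h$1, h$2))) (at p)"
    by (rule has_derivative_compose[where f = "\<lambda>q. (q$1, q$2)" and x = p])
      (use ** in \<open>auto simp: x_def y_def intro!: bounded_linear_imp_has_derivative bounded_linear_Pair bounded_linear_vec_nth\<close>)
  moreover have "v (q$1) (q$2) = q" for q by (simp add: v_def vec_eq_iff forall_2)
  ultimately show ?thesis by (simp add: f_def sum_2)
qed

text \<open>Here Y and Z stand for the first and second partial derivatives of X. The mean curvature equation
  is multiplied by the determinant of the first fundamental form, so that no inverse matrix occurs.\<close>
definition minimal_jet ::
  "(real^2) set \<Rightarrow> (real^2 \<Rightarrow> real^3) \<Rightarrow> (2 \<Rightarrow> real^2 \<Rightarrow> real^3) \<Rightarrow> (2 \<Rightarrow> 2 \<Rightarrow> real^2 \<Rightarrow> real^3) \<Rightarrow> bool" where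
  "minimal_jet U X Y Z \<longleftrightarrow> open U \<and>
    (\<forall>p\<in>U. (X has_derivative (\<lambda>h. \<Sum>a\<in>UNIV. h$a *\<^sub>R Y a p)) (at p)) \<and>
    (\<forall>a. \<forall>p\<in>U. (Y a has_derivative (\<lambda>h. \<Sum>b\<in>UNIV. h$b *\<^sub>R Z a b p)) (at p)) \<and>
    (\<forall>a b. continuous_on U (Z a b)) \<and>
    (\<forall>p\<in>U. let m = (\<lambda>a b. nil_metric (X p) (Y a p) (Y b p));
                 T = (\<lambda>a b. Z a b p + nil_conn (X p) (Y a p) (Y b p))
      in m 1 1 * m 2 2 - m 1 2 * m 1 2 \<noteq> 0 \<and>
         (\<exists>c1 c2. m 2 2 *\<^sub>R T 1 1 - m 1 2 *\<^sub>R T 1 2 - m 1 2 *\<^sub>R T 2 1 + m 1 1 *\<^sub>R T 2 2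
            = c1 *\<^sub>R Y 1 p + c2 *\<^sub>R Y 2 p))"

lemma nil_metric_self_eq_0:
  assumes "nil_metric x v v = 0" shows "v = 0"
proof -
  have "v$1 * v$1 + v$2 * v$2 + nil_theta x v * nil_theta x v = 0"
    using assms by (simp add: nil_metric_def)
  then have "v$1 = 0" "v$2 = 0" "nil_theta x v = 0"
    by (smt (verit) zero_le_square mult_eq_0_iff)+
  then show ?thesis by (simp add: nil_theta_def vec_eq_iff forall_3)
qed

text \<open>The equality case of Cauchy-Schwarz: \<open>E w - F v\<close> has squared length E times
  the Gram determinant, so a vanishing determinant makes \<open>w\<close> a multiple of
  \<open>v\<close>.\<close>

lemma nil_metric_Gram_nonzero:
  assumes "independent {v, w}" "v \<noteq> w"
  shows "nil_metric x v v * nil_metric x w w - nil_metric x v w * nil_metric x v w \<noteq> 0"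
proof
  define E F where "E = nil_metric x v v" and "F = nil_metric x v w"
  assume "nil_metric x v v * nil_metric x w w - nil_metric x v w * nil_metric x v w = 0"
  moreover have ex: "nil_metric x (s *\<^sub>R w - t *\<^sub>R v) (s *\<^sub>R w - t *\<^sub>R v)
      = s * s * nil_metric x w w - 2 * s * t * nil_metric x v w + t * t * nil_metric x v v" for s t
  proof -
    have th: "nil_theta x (s *\<^sub>R w - t *\<^sub>R v) = s * nil_theta x w - t * nil_theta x v"
      by (simp add: nil_theta_def field_simps)
    show ?thesis unfolding nil_metric_def th by (simp add: algebra_simps)
  qed
  then have "nil_metric x (E *\<^sub>R w - F *\<^sub>R v) (E *\<^sub>R w - F *\<^sub>R v)
      = E * (nil_metric x v v * nil_metric x w w - nil_metric x v w * nil_metric x v w)"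
    unfolding ex E_def[symmetric] F_def[symmetric] by (simp add: algebra_simps)
  ultimately have 0: "E *\<^sub>R w - F *\<^sub>R v = 0"
    by (intro nil_metric_self_eq_0) auto
  have "v \<noteq> 0" using assms dependent_zero by blast
  then have "E \<noteq> 0" using nil_metric_self_eq_0 unfolding E_def by blast
  have "E *\<^sub>R w = F *\<^sub>R v" using 0 by simp
  then have "(1 / E) *\<^sub>R (E *\<^sub>R w) = (1 / E) *\<^sub>R (F *\<^sub>R v)" by simp
  then have "w = (F / E) *\<^sub>R v" using \<open>E \<noteq> 0\<close> by simp
  then have "w \<in> span {v}" by (simp add: span_base span_scale)
  moreover have "{v, w} - {w} = {v}" using assms by auto
  ultimately show False using assms unfolding dependent_def by auto
qed

text \<open>After this bridge a surface enters the argument only through \<open>minimal_jet\<close>,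
  a form that is easily carried along a rotation.\<close>

lemma minimal_on_imp_jet:
  assumes "minimal_on U X"
  shows "minimal_jet U X (\<lambda>a. pder a X) (\<lambda>a b. pder b (pder a X))"
proof -
  have C2: "C2_on U X" and ind: "\<And>p. p \<in> U \<Longrightarrow> independent {pder 1 X p, pder 2 X p} \<and> pder 1 X p \<noteq> pder 2 X p"
    and H: "\<And>p. p \<in> U \<Longrightarrow> trace_hessian X p \<in> span {pder 1 X p, pder 2 X p}"
    using assms by (auto simp: minimal_on_def is_immersion_on_def)
  note C2 = C2[unfolded C2_on_def]
  have comb: "\<exists>c1 c2. D *\<^sub>R trace_hessian X p = c1 *\<^sub>R pder 1 X p + c2 *\<^sub>R pder 2 X p" if pU: "p \<in> U" for p and D :: real
  proof -
    obtain k l where "trace_hessian X p - k *\<^sub>R pder 1 X p - l *\<^sub>R pder 2 X p = 0"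
      using H[OF pU] by (auto simp: span_insert span_singleton algebra_simps)
    then have "D *\<^sub>R trace_hessian X p = (D * k) *\<^sub>R pder 1 X p + (D * l) *\<^sub>R pder 2 X p"
      by (simp add: algebra_simps flip: scaleR_scaleR scaleR_add_right)
    then show ?thesis by blast
  qed
  have ff: "first_ff X p $ 1 $ 1 = nil_metric (X p) (pder 1 X p) (pder 1 X p)"
    "first_ff X p $ 1 $ 2 = nil_metric (X p) (pder 1 X p) (pder 2 X p)"
    "first_ff X p $ 2 $ 2 = nil_metric (X p) (pder 2 X p) (pder 2 X p)" for p
    by (auto simp: first_ff_def)
  show ?thesis
    unfolding minimal_jet_def Let_def
  proof (intro conjI allI ballI)
    show "(X has_derivative (\<lambda>h. \<Sum>a\<in>UNIV. h $ a *\<^sub>R pder a X p)) (at p)" if "p \<in> U" for p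
      using C2 that by (intro has_derivative_pder) auto
    show "(pder a X has_derivative (\<lambda>h. \<Sum>b\<in>UNIV. h $ b *\<^sub>R pder b (pder a X) p)) (at p)" if "p \<in> U" for a p
      using C2 that by (intro has_derivative_pder) auto
    fix p assume p: "p \<in> U"
    show G: "nil_metric (X p) (pder 1 X p) (pder 1 X p) * nil_metric (X p) (pder 2 X p) (pder 2 X p) -
      nil_metric (X p) (pder 1 X p) (pder 2 X p) * nil_metric (X p) (pder 1 X p) (pder 2 X p) \<noteq> 0"
      using nil_metric_Gram_nonzero ind[OF p] by blast
    show "\<exists>c1 c2. nil_metric (X p) (pder 2 X p) (pder 2 X p) *\<^sub>R (pder 1 (pder 1 X) p + nil_conn (X p) (pder 1 X p) (pder 1 X p))
      - nil_metric (X p) (pder 1 X p) (pder 2 X p) *\<^sub>R (pder 2 (pder 1 X) p + nil_conn (X p) (pder 1 X p) (pder 2 X p))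
      - nil_metric (X p) (pder 1 X p) (pder 2 X p) *\<^sub>R (pder 1 (pder 2 X) p + nil_conn (X p) (pder 2 X p) (pder 1 X p))
      + nil_metric (X p) (pder 1 X p) (pder 1 X p) *\<^sub>R (pder 2 (pder 2 X) p + nil_conn (X p) (pder 2 X p) (pder 2 X p))
      = c1 *\<^sub>R pder 1 X p + c2 *\<^sub>R pder 2 X p"
      using comb[OF p] det_first_ff_eq[of X p, unfolded ff, OF G] by metis
  qed (use C2 in auto)
qed

section \<open>Touching a minimal surface from one side\<close>

text \<open>Only differentiability of \<open>f'\<close> at 0 is available. If \<open>c\<close> were
  negative, \<open>f'\<close> would be negative just to the right of 0, and the mean value theorem
  would push \<open>f\<close> below \<open>f 0\<close>.\<close>

lemma local_min_second_derivative:
  fixes f :: "real \<Rightarrow> real"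
  assumes d: "d > 0" and f: "\<And>t. \<bar>t\<bar> < d \<Longrightarrow> (f has_real_derivative f' t) (at t)"
    and f': "(f' has_real_derivative c) (at 0)" and min: "\<And>t. \<bar>t\<bar> < d \<Longrightarrow> f 0 \<le> f t"
  shows "f' 0 = 0" "c \<ge> 0"
proof -
  show 0: "f' 0 = 0"
    using DERIV_local_min[OF f d] d min by simp
  show "c \<ge> 0"
  proof (rule ccontr)
    assume "\<not> c \<ge> 0"
    then obtain e where e: "e > 0" "\<And>h. 0 < h \<Longrightarrow> h < e \<Longrightarrow> f' h < 0"
      using DERIV_neg_dec_right[OF f'] 0 by auto
    define h where "h = min (d/2) (e/2)"
    have h: "0 < h" "h < d" "h < e" using d e by (auto simp: h_def)
    have "\<exists>z>0. z < h \<and> f h - f 0 = (h - 0) * f' z"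
      by (rule MVT2) (use h f in auto)
    then obtain z where z: "0 < z" "z < h" "f h - f 0 = h * f' z" by auto
    have "h * f' z < 0" using e(2)[of z] z h by (simp add: mult_less_0_iff)
    then show False using z min[of h] h by auto
  qed
qed

text \<open>Here \<open>m12\<close> is the sum of both off-diagonal entries. After multiplication by
  \<open>E\<close> the expression is a nonnegative multiple of \<open>m11\<close> plus the quadratic
  form evaluated at \<open>(F, - E)\<close>.\<close>

lemma trace_nonneg_2:
  fixes m11 m12 m22 E F G :: real
  assumes q: "\<And>s t. s * s * m11 + s * t * m12 + t * t * m22 \<ge> 0"
    and "E > 0" "E * G - F * F \<ge> 0"
  shows "G * m11 - F * m12 + E * m22 \<ge> 0"
proof -
  have "m11 \<ge> 0" using q[of 1 0] by simp
  have "E * (G * m11 - F * m12 + E * m22) = (E * G - F * F) * m11 + (F * F * m11 + F * (- E) * m12 + (-E) * (-E) * m22)"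
    by algebra
  also have "\<dots> \<ge> 0"
    by (rule add_nonneg_nonneg[OF mult_nonneg_nonneg[OF assms(3) \<open>m11 \<ge> 0\<close>] q])
  finally show ?thesis using \<open>E > 0\<close> by (simp add: zero_le_mult_iff)
qed

text \<open>Lagrange's identity in the orthonormal coframe dx1, dx2, \<open>nil_theta\<close>: the
  right side is the squared length of the cross product.\<close>

lemma Gram_eq_cross:
  "nil_metric x v v * nil_metric x w w - nil_metric x v w * nil_metric x v w =
    (v$2 * nil_theta x w - nil_theta x v * w$2)\<^sup>2 + (nil_theta x v * w$1 - v$1 * nil_theta x w)\<^sup>2
    + (v$1 * w$2 - v$2 * w$1)\<^sup>2"
  unfolding nil_metric_def by algebra

lemma minimal_jet_metric_pos:
  assumes "minimal_jet U X Y Z" "p \<in> U"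
  shows "nil_metric (X p) (Y 1 p) (Y 1 p) > 0"
    and "nil_metric (X p) (Y 1 p) (Y 1 p) * nil_metric (X p) (Y 2 p) (Y 2 p)
         - nil_metric (X p) (Y 1 p) (Y 2 p) * nil_metric (X p) (Y 1 p) (Y 2 p) > 0"
proof -
  let ?D = "nil_metric (X p) (Y 1 p) (Y 1 p) * nil_metric (X p) (Y 2 p) (Y 2 p)
         - nil_metric (X p) (Y 1 p) (Y 2 p) * nil_metric (X p) (Y 1 p) (Y 2 p)"
  have "?D \<noteq> 0" using assms by (simp add: minimal_jet_def Let_def)
  moreover have "?D \<ge> 0" unfolding Gram_eq_cross by simp
  ultimately show D: "?D > 0" by simp
  have "nil_metric (X p) (Y 1 p) (Y 1 p) \<ge> 0" by (simp add: nil_metric_def)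
  moreover have "nil_metric (X p) (Y 1 p) (Y 1 p) \<noteq> 0"
  proof
    assume "nil_metric (X p) (Y 1 p) (Y 1 p) = 0"
    then have "?D \<le> 0" by simp
    then show False using D by linarith
  qed
  ultimately show "nil_metric (X p) (Y 1 p) (Y 1 p) > 0" by simp
qed

text \<open>The second-derivative test on every line through \<open>p\<close>. The mixed derivatives
  \<open>v12\<close> and \<open>v21\<close> stay separate, since only their sum matters and no
  symmetry has to be proved.\<close>

lemma local_min_along_line:
  fixes v :: "real^2 \<Rightarrow> real"
  assumes "open U" "p \<in> U"
    and v: "\<And>q. q \<in> U \<Longrightarrow> (v has_derivative (\<lambda>h. h$1 * v1 q + h$2 * v2 q)) (at q)"
    and v1: "(v1 has_derivative (\<lambda>h. h$1 * v11 + h$2 * v12)) (at p)"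
    and v2: "(v2 has_derivative (\<lambda>h. h$1 * v21 + h$2 * v22)) (at p)"
    and min: "\<forall>\<^sub>F q in nhds p. v p \<le> v q"
  shows "v1 p = 0" "v2 p = 0" "s * s * v11 + s * t * (v12 + v21) + t * t * v22 \<ge> 0"
proof -
  have *: "s * v1 p + t * v2 p = 0 \<and> s * s * v11 + s * t * (v12 + v21) + t * t * v22 \<ge> 0" for s t
  proof -
    define d :: "real^2" where "d = vector [s, t]"
    have d [simp]: "d$1 = s" "d$2 = t" by (auto simp: d_def)
    have "\<forall>\<^sub>F q in nhds p. q \<in> U \<and> v p \<le> v q"
      using min assms(1,2) by (auto intro: eventually_conj eventually_nhds_in_open)
    moreover have lim: "((\<lambda>r::real. p + r *\<^sub>R d) \<longlongrightarrow> p) (nhds 0)"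
      by (intro tendsto_eq_intros) (auto intro: filterlim_ident)
    ultimately have "\<forall>\<^sub>F r in nhds 0. p + r *\<^sub>R d \<in> U \<and> v p \<le> v (p + r *\<^sub>R d)"
      by (auto simp: filterlim_iff)
    then obtain e where e: "e > 0" "\<And>r. \<bar>r\<bar> < e \<Longrightarrow> p + r *\<^sub>R d \<in> U \<and> v p \<le> v (p + r *\<^sub>R d)"
      by (auto simp: eventually_nhds_metric dist_norm)
    have line: "((\<lambda>r. p + r *\<^sub>R d) has_derivative (\<lambda>r. r *\<^sub>R d)) (at r)" for r
      by (auto intro!: derivative_eq_intros)
    have A: "((\<lambda>r. v (p + r *\<^sub>R d)) has_real_derivative s * v1 (p + r *\<^sub>R d) + t * v2 (p + r *\<^sub>R d)) (at r)"
      if "\<bar>r\<bar> < e" for r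
      unfolding has_field_derivative_def
      by (rule has_derivative_eq_rhs[OF has_derivative_compose[OF line v]])
        (use e(2)[OF that] in \<open>auto simp: algebra_simps\<close>)
    have B: "((\<lambda>r. v1 (p + r *\<^sub>R d)) has_real_derivative s * v11 + t * v12) (at 0)"
      unfolding has_field_derivative_def
      by (rule has_derivative_eq_rhs[OF has_derivative_compose[OF line, of v1]])
        (use v1 in \<open>auto simp: algebra_simps\<close>)
    have C: "((\<lambda>r. v2 (p + r *\<^sub>R d)) has_real_derivative s * v21 + t * v22) (at 0)"
      unfolding has_field_derivative_def
      by (rule has_derivative_eq_rhs[OF has_derivative_compose[OF line, of v2]])
        (use v2 in \<open>auto simp: algebra_simps\<close>)
    have D: "((\<lambda>r. s * v1 (p + r *\<^sub>R d) + t * v2 (p + r *\<^sub>R d)) has_real_derivative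
        s * (s * v11 + t * v12) + t * (s * v21 + t * v22)) (at 0)"
      by (intro DERIV_add DERIV_cmult B C)
    show ?thesis
      using local_min_second_derivative[OF e(1) A D] e by (simp add: algebra_simps)
  qed
  show "v1 p = 0" using *[of 1 0] by simp
  show "v2 p = 0" using *[of 0 1] by simp
  show "s * s * v11 + s * t * (v12 + v21) + t * t * v22 \<ge> 0" using * by blast
qed

text \<open>\<open>H\<close> is the covariant Hessian of \<open>F\<close>. The second derivatives of
  F along X are those of \<open>F\<close> plus the pairing of \<open>g\<close> with the entries of
  \<open>Z\<close>. The minimal surface equation replaces the contracted \<open>Z\<close> terms by
  connection terms and a tangent vector, and the first-order condition makes \<open>g\<close>
  annihilate the tangent vector. What remains is the trace of \<open>H\<close> over the tangent
  plane, up to the Gram determinant.\<close>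

lemma minimal_jet_touch:
  fixes g :: "real^3 \<Rightarrow> real^3"
  assumes jet: "minimal_jet U X Y Z" and p: "p \<in> U"
    and S: "open S" "X p \<in> S" and g: "\<And>x. x \<in> S \<Longrightarrow> (F has_derivative (\<lambda>h. g x \<bullet> h)) (at x)"
    and g': "(g has_derivative g') (at (X p))"
    and min: "\<forall>\<^sub>F q in nhds p. F (X p) \<le> F (X q)"
  defines "m \<equiv> \<lambda>a b. nil_metric (X p) (Y a p) (Y b p)"
    and "H \<equiv> \<lambda>v w. g' v \<bullet> w - g (X p) \<bullet> nil_conn (X p) v w"
  shows "g (X p) \<bullet> Y a p = 0"
    and "m 2 2 * H (Y 1 p) (Y 1 p) - m 1 2 * (H (Y 1 p) (Y 2 p) + H (Y 2 p) (Y 1 p)) + m 1 1 * H (Y 2 p) (Y 2 p) \<ge> 0"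
proof -
  note J = jet[unfolded minimal_jet_def]
  have contX: "continuous_on U X"
    using J by (meson continuous_at_imp_continuous_on has_derivative_continuous)
  define V where "V = U \<inter> X -` S"
  have V: "open V" "p \<in> V" "V \<subseteq> U" "\<And>q. q \<in> V \<Longrightarrow> X q \<in> S"
    using J p S contX by (auto simp: V_def continuous_on_open_vimage Int_commute)
  have X: "(X has_derivative (\<lambda>h. h$1 *\<^sub>R Y 1 q + h$2 *\<^sub>R Y 2 q)) (at q)" if "q \<in> U" for q
    using J that by (simp add: sum_2)
  have Y: "(Y a has_derivative (\<lambda>h. h$1 *\<^sub>R Z a 1 p + h$2 *\<^sub>R Z a 2 p)) (at p)" for a
    using J p by (simp add: sum_2)
  have g'l: "linear g'" using has_derivative_linear[OF g'] .
  have v: "((\<lambda>q. F (X q)) has_derivative (\<lambda>h. h$1 * (g (X q) \<bullet> Y 1 q) + h$2 * (g (X q) \<bullet> Y 2 q))) (at q)"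
    if "q \<in> V" for q
    using has_derivative_compose[OF X g, of q] V that by (auto simp: inner_add_right)
  have gX: "((\<lambda>q. g (X q)) has_derivative (\<lambda>h. h$1 *\<^sub>R g' (Y 1 p) + h$2 *\<^sub>R g' (Y 2 p))) (at p)"
    using has_derivative_compose[OF X[OF p] g'] by (simp add: linear_add[OF g'l] linear_scale[OF g'l])
  have w: "((\<lambda>q. g (X q) \<bullet> Y a q) has_derivative
      (\<lambda>h. h$1 * (g' (Y 1 p) \<bullet> Y a p + g (X p) \<bullet> Z a 1 p) + h$2 * (g' (Y 2 p) \<bullet> Y a p + g (X p) \<bullet> Z a 2 p))) (at p)" for a
    by (rule has_derivative_eq_rhs[OF has_derivative_inner[OF gX Y]])
      (auto simp: inner_add_left inner_add_right algebra_simps fun_eq_iff)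
  note L = local_min_along_line[OF V(1,2) v w w min]
  show a: "g (X p) \<bullet> Y a p = 0" for a using L(1,2) exhaust_2[of a] by auto
  have pos: "m 1 1 > 0" "m 1 1 * m 2 2 - m 1 2 * m 1 2 \<ge> 0"
    using minimal_jet_metric_pos[OF jet p] by (auto simp: m_def)
  note T = trace_nonneg_2[OF L(3) pos]
  obtain c1 c2 where c: "m 2 2 *\<^sub>R (Z 1 1 p + nil_conn (X p) (Y 1 p) (Y 1 p)) - m 1 2 *\<^sub>R (Z 1 2 p + nil_conn (X p) (Y 1 p) (Y 2 p))
     - m 1 2 *\<^sub>R (Z 2 1 p + nil_conn (X p) (Y 2 p) (Y 1 p)) + m 1 1 *\<^sub>R (Z 2 2 p + nil_conn (X p) (Y 2 p) (Y 2 p))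
     = c1 *\<^sub>R Y 1 p + c2 *\<^sub>R Y 2 p"
    using J p unfolding Let_def m_def by meson
  have "g (X p) \<bullet> (c1 *\<^sub>R Y 1 p + c2 *\<^sub>R Y 2 p) = 0" using a by (simp add: inner_add_right)
  then show "m 2 2 * H (Y 1 p) (Y 1 p) - m 1 2 * (H (Y 1 p) (Y 2 p) + H (Y 2 p) (Y 1 p)) + m 1 1 * H (Y 2 p) (Y 2 p) \<ge> 0"
    using T unfolding c[symmetric] by (simp add: inner_add_right inner_diff_right H_def algebra_simps)
qed

section \<open>The logarithmic barrier\<close>

lemma has_derivative_vector_3:
  fixes f1 f2 f3 :: "'a::real_normed_vector \<Rightarrow> real"
  assumes "(f1 has_derivative d1) F" "(f2 has_derivative d2) F" "(f3 has_derivative d3) F"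
  shows "((\<lambda>x. vector [f1 x, f2 x, f3 x] :: real^3) has_derivative (\<lambda>h. vector [d1 h, d2 h, d3 h])) F"
proof -
  have eq: "vector [r, s, t] = r *\<^sub>R axis 1 1 + s *\<^sub>R axis 2 1 + t *\<^sub>R (axis 3 1 :: real^3)" for r s t :: real
    by (simp add: vec_eq_iff forall_3 axis_def)
  show ?thesis unfolding eq by (intro has_derivative_add has_derivative_scaleR_left assms)
qed

definition nil_z :: "real^3 \<Rightarrow> real" where "nil_z x = x$3 - x$1 * x$2 / 2"

definition nil_q :: "real^3 \<Rightarrow> real" where "nil_q x = (x$2)\<^sup>2 + (nil_z x)\<^sup>2"

text \<open>The profile \<open>w - w^2 / 4\<close> vanishes at w = 0, equals 3/4 at w = 1, and has
  slope between 1/2 and 1 in between; its concavity supplies the strict sign.\<close>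

definition nil_barrier :: "real \<Rightarrow> real \<Rightarrow> real^3 \<Rightarrow> real" where
  "nil_barrier k e x = x$1 + k * (e * ln (nil_q x) - (e * ln (nil_q x))\<^sup>2 / 4)"

definition barrier_slope :: "real \<Rightarrow> real \<Rightarrow> real \<Rightarrow> real" where
  "barrier_slope k e q = k * e * (1 - e * ln q / 2) / q"

text \<open>The coordinate gradient: it represents the differential through the Euclidean inner
  product, not through the metric of Nil.\<close>

definition barrier_grad :: "real \<Rightarrow> real \<Rightarrow> real^3 \<Rightarrow> real^3" where
  "barrier_grad k e x = (let a = barrier_slope k e (nil_q x) in
     vector [1 - x$2 * nil_z x * a, 2 * x$2 * a - x$1 * nil_z x * a, 2 * nil_z x * a])"

text \<open>The derivative of the coordinate gradient in direction \<open>v\<close>: z' and a' are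
  the derivatives of \<open>nil_z\<close> and of the slope, and \<open>c\<close> is the derivative
  of the slope with respect to q.\<close>

definition barrier_hess :: "real \<Rightarrow> real \<Rightarrow> real \<Rightarrow> real^3 \<Rightarrow> real^3 \<Rightarrow> real^3" where
  "barrier_hess a c z x v = (let z' = v$3 - (x$1 * v$2 + x$2 * v$1) / 2;
        a' = c * (2 * x$2 * v$2 + 2 * z * z') in
     vector [- (v$2 * z * a + x$2 * z' * a + x$2 * z * a'),
             2 * v$2 * a + 2 * x$2 * a' - v$1 * z * a - x$1 * z' * a - x$1 * z * a',
             2 * z' * a + 2 * z * a'])"

lemma has_derivative_nth: "((\<lambda>x. x $ i) has_derivative (\<lambda>h. h $ i)) F"
  by (rule bounded_linear_imp_has_derivative) (rule bounded_linear_vec_nth)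

lemma has_derivative_nil_z:
  "(nil_z has_derivative (\<lambda>v. v$3 - (x$1 * v$2 + x$2 * v$1) / 2)) (at x)"
  unfolding nil_z_def by (auto intro!: derivative_eq_intros has_derivative_nth)

lemma has_derivative_nil_q:
  "(nil_q has_derivative (\<lambda>v. 2 * x$2 * v$2 + 2 * nil_z x * (v$3 - (x$1 * v$2 + x$2 * v$1) / 2))) (at x)"
  unfolding nil_q_def by (auto intro!: derivative_eq_intros has_derivative_nth has_derivative_nil_z)

lemma has_derivative_barrier:
  assumes "nil_q x > 0"
  shows "(nil_barrier k e has_derivative (\<lambda>h. barrier_grad k e x \<bullet> h)) (at x)"
proof -
  have "((\<lambda>q. k * (e * ln q - (e * ln q)\<^sup>2 / 4)) has_real_derivative barrier_slope k e (nil_q x)) (at (nil_q x))"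
    using assms by (auto intro!: derivative_eq_intros simp: barrier_slope_def field_simps power2_eq_square)
  note 1 = has_derivative_compose[OF has_derivative_nil_q this[unfolded has_field_derivative_def]]
  show ?thesis
    unfolding nil_barrier_def
    by (rule has_derivative_eq_rhs[OF has_derivative_add[OF has_derivative_nth 1]])
      (simp add: fun_eq_iff barrier_grad_def Let_def inner_vec_def sum_3 field_simps)
qed

lemma has_derivative_barrier_grad:
  fixes k e :: real
  assumes "nil_q x > 0"
  defines "a \<equiv> barrier_slope k e (nil_q x)"
  shows "(barrier_grad k e has_derivative
     barrier_hess a (- (nil_q x * a + k * e\<^sup>2 / 2) / (nil_q x)\<^sup>2) (nil_z x) x) (at x)"
proof -
  define c where "c = - (nil_q x * a + k * e\<^sup>2 / 2) / (nil_q x)\<^sup>2"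
  define zd where "zd = (\<lambda>v::real^3. v$3 - (x$1 * v$2 + x$2 * v$1) / 2)"
  define sd where "sd = (\<lambda>v::real^3. c * (2 * x$2 * v$2 + 2 * nil_z x * zd v))"
  \<comment> \<open>The slope is A/q with A = k e (1 - e ln q / 2); since q times the derivative of
    A is - k e^2 / 2, the quotient rule gives \<open>c\<close>.\<close>
  have "(barrier_slope k e has_real_derivative c) (at (nil_q x))"
    unfolding barrier_slope_def a_def c_def
    using assms by (auto intro!: derivative_eq_intros simp: field_simps power2_eq_square)
  then have s: "((\<lambda>x. barrier_slope k e (nil_q x)) has_derivative sd) (at x)"
    unfolding has_field_derivative_def sd_def zd_def
    by (rule has_derivative_compose[OF has_derivative_nil_q])
  have z: "(nil_z has_derivative zd) (at x)"
    unfolding zd_def by (rule has_derivative_nil_z)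
  have 1: "((\<lambda>x. 1 - x$2 * nil_z x * barrier_slope k e (nil_q x)) has_derivative
      (\<lambda>v. - (v$2 * nil_z x * a + x$2 * zd v * a + x$2 * nil_z x * sd v))) (at x)"
    by (rule has_derivative_eq_rhs[OF has_derivative_diff[OF has_derivative_const has_derivative_mult[OF has_derivative_mult[OF has_derivative_nth z] s]]])
      (simp add: a_def fun_eq_iff algebra_simps)
  have 2: "((\<lambda>x. 2 * x$2 * barrier_slope k e (nil_q x) - x$1 * nil_z x * barrier_slope k e (nil_q x)) has_derivative
      (\<lambda>v. 2 * v$2 * a + 2 * x$2 * sd v - v$1 * nil_z x * a - x$1 * zd v * a - x$1 * nil_z x * sd v)) (at x)"
    by (rule has_derivative_eq_rhs[OF has_derivative_diff[OF has_derivative_mult[OF has_derivative_mult[OF has_derivative_const has_derivative_nth] s] has_derivative_mult[OF has_derivative_mult[OF has_derivative_nth z] s]]])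
      (simp add: a_def fun_eq_iff algebra_simps)
  have 3: "((\<lambda>x. 2 * nil_z x * barrier_slope k e (nil_q x)) has_derivative
      (\<lambda>v. 2 * zd v * a + 2 * nil_z x * sd v)) (at x)"
    by (rule has_derivative_eq_rhs[OF has_derivative_mult[OF has_derivative_mult[OF has_derivative_const z] s]])
      (simp add: a_def fun_eq_iff algebra_simps)
  show ?thesis
    unfolding barrier_grad_def Let_def c_def[symmetric]
    by (rule has_derivative_eq_rhs[OF has_derivative_vector_3[OF 1 2 3]])
      (simp add: barrier_hess_def Let_def fun_eq_iff zd_def sd_def)
qed

section \<open>Mean convexity of the level sets of the barrier\<close>

text \<open>Passing to the orthonormal coframe dx1, dx2, \<open>nil_theta\<close> removes the
  explicit dependence on the first coordinate; the three coefficients are the \<open>f1\<close>,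
  \<open>f2\<close>, \<open>f3\<close> of the curvature computation.\<close>

lemma barrier_grad_frame:
  "vector [1 - x$2 * z * a, 2 * x$2 * a - x$1 * z * a, 2 * z * a] \<bullet> v =
     (1 - 2 * x$2 * z * a) * v$1 + 2 * x$2 * a * v$2 + 2 * z * a * nil_theta x v"
  by (simp add: inner_vec_def sum_3 nil_theta_def field_simps)

text \<open>The Hessian of the barrier in the left-invariant frame, the barrier being x1 + u(y,z) with
  a the slope of u as a function of q = y^2 + z^2, and c the derivative of a.\<close>
lemma barrier_hess_frame:
  fixes x v w :: "real^3" and a c :: real
  defines "y \<equiv> x$2" and "z \<equiv> nil_z x" and "t \<equiv> nil_theta x v" and "s \<equiv> nil_theta x w"
  defines "g \<equiv> vector [1 - y * z * a, 2 * y * a - x$1 * z * a, 2 * z * a] :: real^3"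
  defines "uyy \<equiv> 2 * a + 4 * y * y * c" and "uyz \<equiv> 4 * y * z * c" and "uzz \<equiv> 2 * a + 4 * z * z * c"
  defines "h12 \<equiv> - y * uyz - z * a" and "h13 \<equiv> - y * uzz + y * a" and "h23 \<equiv> uyz - (1 - 2 * y * z * a) / 2"
  shows "barrier_hess a c z x v \<bullet> w - g \<bullet> nil_conn x v w =
     y * y * uzz * (v$1 * w$1) + uyy * (v$2 * w$2) + uzz * (t * s)
     + h12 * (v$1 * w$2 + v$2 * w$1) + h13 * (v$1 * s + t * w$1) + h23 * (v$2 * s + t * w$2)"
proof -
  define z' where "z' = t - y * v$1"
  define a' where "a' = c * (2 * y * v$2 + 2 * z * z')"
  have z': "v$3 - (x$1 * v$2 + x$2 * v$1) / 2 = z'"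
    by (simp add: z'_def t_def y_def nil_theta_def field_simps)
  have 1: "barrier_hess a c z x v \<bullet> w = - (v$2 * z * a + 2 * y * z' * a + 2 * y * z * a') * w$1
      + (2 * v$2 * a + 2 * y * a' - v$1 * z * a) * w$2 + (2 * z' * a + 2 * z * a') * s"
    unfolding barrier_hess_def Let_def z' unfolding y_def[symmetric] unfolding a'_def[symmetric]
    by (simp add: inner_vec_def sum_3 s_def nil_theta_def y_def field_simps)
  \<comment> \<open>The contact form annihilates the connection term, so only the first two frame
    coefficients of \<open>g\<close> meet it.\<close>
  have "nil_theta x (nil_conn x v w) = 0"
    by (simp add: nil_conn_def Let_def nil_theta_def field_simps)
  then have 2: "g \<bullet> nil_conn x v w =
      (1 - 2 * y * z * a) * ((s * v$2 + t * w$2) / 2) - 2 * y * a * ((s * v$1 + t * w$1) / 2)"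
    unfolding g_def y_def barrier_grad_frame
    by (simp add: nil_conn_def Let_def s_def t_def field_simps)
  show ?thesis
    unfolding 1 2 a'_def z'_def uyy_def uyz_def uzz_def h12_def h13_def h23_def
    by (simp add: field_simps)
qed

text \<open>The cross product of p and r is normal to their plane, hence l times f with l fixed by
  its first entry. The trace of H over the plane, times the Gram determinant, becomes l^2 (|f|^2 tr
  H - H(f,f)), which no longer mentions p and r except through l.\<close>

lemma trace_on_orthogonal_plane:
  fixes p1 p2 p3 r1 r2 r3 f1 f2 f3 :: real and h11 h12 h13 h22 h23 h33 :: real
  assumes p: "f1 * p1 + f2 * p2 + f3 * p3 = 0" and r: "f1 * r1 + f2 * r2 + f3 * r3 = 0" and f: "f1 \<noteq> 0"
  defines "H \<equiv> \<lambda>v1 v2 v3 w1 w2 w3. h11 * (v1 * w1) + h22 * (v2 * w2) + h33 * (v3 * w3)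
     + h12 * (v1 * w2 + v2 * w1) + h13 * (v1 * w3 + v3 * w1) + h23 * (v2 * w3 + v3 * w2)"
  shows "(r1*r1 + r2*r2 + r3*r3) * H p1 p2 p3 p1 p2 p3
      - (p1*r1 + p2*r2 + p3*r3) * (H p1 p2 p3 r1 r2 r3 + H r1 r2 r3 p1 p2 p3)
      + (p1*p1 + p2*p2 + p3*p3) * H r1 r2 r3 r1 r2 r3 =
    ((p2*r3 - p3*r2) / f1)\<^sup>2 * (h11 * (f2*f2 + f3*f3) + h22 * (f1*f1 + f3*f3) + h33 * (f1*f1 + f2*f2)
      - 2 * (h12 * (f1 * f2) + h13 * (f1 * f3) + h23 * (f2 * f3)))"
    and "(p2*r3 - p3*r2)\<^sup>2 + (p3*r1 - p1*r3)\<^sup>2 + (p1*r2 - p2*r1)\<^sup>2 =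
      ((p2*r3 - p3*r2) / f1)\<^sup>2 * (f1*f1 + f2*f2 + f3*f3)"
proof -
  define l where "l = (p2*r3 - p3*r2) / f1"
  have n1: "p2*r3 - p3*r2 = l * f1" using f by (simp add: l_def)
  have fp: "f1 * p1 = - (f2 * p2 + f3 * p3)" and fr: "f1 * r1 = - (f2 * r2 + f3 * r3)"
    using p r by auto
  have "f1 * (p3*r1 - p1*r3) = p3 * (f1 * r1) - r3 * (f1 * p1)" by (simp add: algebra_simps)
  also have "\<dots> = f2 * (p2*r3 - p3*r2)" unfolding fp fr by (simp add: algebra_simps)
  finally have "f1 * (p3*r1 - p1*r3) = f1 * (l * f2)" by (simp add: n1 mult.commute)
  then have n2: "p3*r1 - p1*r3 = l * f2" using f by simp
  have "f1 * (p1*r2 - p2*r1) = r2 * (f1 * p1) - p2 * (f1 * r1)" by (simp add: algebra_simps)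
  also have "\<dots> = f3 * (p2*r3 - p3*r2)" unfolding fp fr by (simp add: algebra_simps)
  finally have "f1 * (p1*r2 - p2*r1) = f1 * (l * f3)" by (simp add: n1 mult.commute)
  then have n3: "p1*r2 - p2*r1 = l * f3" using f by simp
  show "(p2*r3 - p3*r2)\<^sup>2 + (p3*r1 - p1*r3)\<^sup>2 + (p1*r2 - p2*r1)\<^sup>2 =
      ((p2*r3 - p3*r2) / f1)\<^sup>2 * (f1*f1 + f2*f2 + f3*f3)"
    unfolding l_def[symmetric] unfolding n1 n2 n3 by (simp add: algebra_simps power2_eq_square)
  define m1 m2 m3 where m: "m1 = p2*r3 - p3*r2" "m2 = p3*r1 - p1*r3" "m3 = p1*r2 - p2*r1"
  have "(r1*r1 + r2*r2 + r3*r3) * H p1 p2 p3 p1 p2 p3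
      - (p1*r1 + p2*r2 + p3*r3) * (H p1 p2 p3 r1 r2 r3 + H r1 r2 r3 p1 p2 p3)
      + (p1*p1 + p2*p2 + p3*p3) * H r1 r2 r3 r1 r2 r3 =
     h11 * (m2*m2 + m3*m3) + h22 * (m1*m1 + m3*m3) + h33 * (m1*m1 + m2*m2)
      - 2 * (h12 * (m1 * m2) + h13 * (m1 * m3) + h23 * (m2 * m3))"
  proof -
    define E F G where efg: "E = p1*p1 + p2*p2 + p3*p3" "F = p1*r1 + p2*r2 + p3*r3" "G = r1*r1 + r2*r2 + r3*r3"
    \<comment> \<open>With the cross product m these are the entries of G p p^T - F (p r^T + r p^T)
      + E r r^T = |m|^2 I - m m^T, valid for all p and r.\<close>
    have d: "G * (p1*p1) - F * (2 * (p1*r1)) + E * (r1*r1) = m2*m2 + m3*m3"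
      "G * (p2*p2) - F * (2 * (p2*r2)) + E * (r2*r2) = m1*m1 + m3*m3"
      "G * (p3*p3) - F * (2 * (p3*r3)) + E * (r3*r3) = m1*m1 + m2*m2"
      "G * (p1*p2) - F * (p1*r2 + p2*r1) + E * (r1*r2) = - (m1*m2)"
      "G * (p1*p3) - F * (p1*r3 + p3*r1) + E * (r1*r3) = - (m1*m3)"
      "G * (p2*p3) - F * (p2*r3 + p3*r2) + E * (r2*r3) = - (m2*m3)"
      unfolding efg m by (simp_all add: algebra_simps)
    have "G * H p1 p2 p3 p1 p2 p3 - F * (H p1 p2 p3 r1 r2 r3 + H r1 r2 r3 p1 p2 p3) + E * H r1 r2 r3 r1 r2 r3
      = h11 * (G * (p1*p1) - F * (2 * (p1*r1)) + E * (r1*r1))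
      + h22 * (G * (p2*p2) - F * (2 * (p2*r2)) + E * (r2*r2))
      + h33 * (G * (p3*p3) - F * (2 * (p3*r3)) + E * (r3*r3))
      + 2 * h12 * (G * (p1*p2) - F * (p1*r2 + p2*r1) + E * (r1*r2))
      + 2 * h13 * (G * (p1*p3) - F * (p1*r3 + p3*r1) + E * (r1*r3))
      + 2 * h23 * (G * (p2*p3) - F * (p2*r3 + p3*r2) + E * (r2*r3))"
      unfolding H_def by (simp add: algebra_simps)
    then show ?thesis unfolding d efg[symmetric] by (simp add: algebra_simps)
  qed
  also have "\<dots> = l\<^sup>2 * (h11 * (f2*f2 + f3*f3) + h22 * (f1*f1 + f3*f3) + h33 * (f1*f1 + f2*f2)
      - 2 * (h12 * (f1 * f2) + h13 * (f1 * f3) + h23 * (f2 * f3)))"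
    unfolding m n1 n2 n3 by (simp add: algebra_simps power2_eq_square)
  finally show "(r1*r1 + r2*r2 + r3*r3) * H p1 p2 p3 p1 p2 p3
      - (p1*r1 + p2*r2 + p3*r3) * (H p1 p2 p3 r1 r2 r3 + H r1 r2 r3 p1 p2 p3)
      + (p1*p1 + p2*p2 + p3*p3) * H r1 r2 r3 r1 r2 r3 =
    ((p2*r3 - p3*r2) / f1)\<^sup>2 * (h11 * (f2*f2 + f3*f3) + h22 * (f1*f1 + f3*f3) + h33 * (f1*f1 + f2*f2)
      - 2 * (h12 * (f1 * f2) + h13 * (f1 * f3) + h23 * (f2 * f3)))"
    unfolding l_def .
qed

text \<open>The curvature expression of the next lemma times q, in terms of al = y^2/q, ga = z^2/q,
  be = y z/q and i = 1/q. The good term is the one with factor B.\<close>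
lemma barrier_bound_aux:
  fixes al ga be i A B :: real
  assumes "0 \<le> al" "al \<le> 1" "0 \<le> ga" "\<bar>be\<bar> \<le> 1/2" "0 \<le> i" "i \<le> 1"
    "0 \<le> B" "B \<le> A" "A \<le> 1/8" "20 * A\<^sup>2 < 3 * B"
  defines "f \<equiv> 1 - 2 * be * A"
  shows "4 * al * A\<^sup>2 * (2 * A - 4 * ga * (A + B)) + 8 * A ^ 3 * i - 4 * B * f\<^sup>2
    - 8 * f * be * A * (A + 2 * B) + 4 * be * A\<^sup>2 * f < 0"
proof -
  have A0: "0 \<le> A" using assms by simp
  have "\<bar>2 * be * A\<bar> \<le> 1 * (1/8)"
    unfolding abs_mult using assms A0 by (intro mult_mono) auto
  then have f: "7/8 \<le> f" "f \<le> 9/8" by (auto simp: f_def abs_le_iff)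
  have A3: "8 * A ^ 3 \<le> A\<^sup>2"
    using mult_right_mono[of A "1/8" "A\<^sup>2"] assms by (simp add: power3_eq_cube power2_eq_square)
  have t1: "4 * al * A\<^sup>2 * (2 * A - 4 * ga * (A + B)) \<le> A\<^sup>2"
  proof -
    have "4 * al * A\<^sup>2 * (2 * A - 4 * ga * (A + B)) \<le> 4 * al * A\<^sup>2 * (2 * A)"
      using assms A0 by (intro mult_left_mono) auto
    also have "\<dots> = al * (8 * A ^ 3)" by (simp add: power3_eq_cube power2_eq_square)
    also have "\<dots> \<le> 1 * (8 * A ^ 3)" using assms A0 by (intro mult_right_mono) auto
    finally show ?thesis using A3 by simp
  qed
  have t2: "8 * A ^ 3 * i \<le> A\<^sup>2"
    using mult_left_mono[of i 1 "8 * A ^ 3"] A3 assms A0 by simp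
  have t3: "3 * B \<le> 4 * B * f\<^sup>2"
  proof -
    have "(7/8)\<^sup>2 \<le> f\<^sup>2" using f by (intro power_mono) auto
    then have "3 \<le> 4 * f\<^sup>2" by (simp add: power2_eq_square)
    then show ?thesis using mult_left_mono[of 3 "4 * f\<^sup>2" B] assms by (simp add: mult.commute mult.left_commute)
  qed
  have t4: "\<bar>8 * f * be * A * (A + 2 * B)\<bar> \<le> 27/2 * A\<^sup>2"
  proof -
    have "\<bar>8 * f * be * A * (A + 2 * B)\<bar> = (8 * f) * \<bar>be\<bar> * A * (A + 2 * B)"
      using f A0 \<open>0 \<le> B\<close> by (simp add: abs_mult)
    also have "\<dots> \<le> 9 * (1/2) * A * (3 * A)"
      using f assms A0 by (intro mult_mono) auto
    finally show ?thesis by (simp add: power2_eq_square)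
  qed
  have t5: "\<bar>4 * be * A\<^sup>2 * f\<bar> \<le> 9/4 * A\<^sup>2"
  proof -
    have "\<bar>4 * be * A\<^sup>2 * f\<bar> = 4 * \<bar>be\<bar> * A\<^sup>2 * f"
      using f A0 by (simp add: abs_mult)
    also have "\<dots> \<le> 4 * (1/2) * A\<^sup>2 * (9/8)"
      using f assms A0 by (intro mult_mono) auto
    finally show ?thesis by simp
  qed
  \<comment> \<open>The error terms add up to at most (1 + 1 + 27/2 + 9/4) A^2 = 71/4 A^2 \<le> 20
    A^2 < 3 B, which the good term absorbs.\<close>
  show ?thesis using t1 t2 t3 t4 t5 assms(10) by linarith
qed

text \<open>The expression is |grad F|^2 times the Laplacian of F minus Hess F(grad F, grad F).\<close>
lemma barrier_curvature_neg:
  fixes y z A B q :: real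
  assumes q: "q = y\<^sup>2 + z\<^sup>2" "q \<ge> 1" and AB: "0 \<le> B" "B \<le> A" "A \<le> 1/8" "20 * A\<^sup>2 < 3 * B"
  defines "a \<equiv> A / q" and "c \<equiv> - (A + B) / q\<^sup>2"
  defines "f1 \<equiv> 1 - 2 * y * z * a" and "f2 \<equiv> 2 * y * a" and "f3 \<equiv> 2 * z * a"
  defines "uyy \<equiv> 2 * a + 4 * y * y * c" and "uyz \<equiv> 4 * y * z * c" and "uzz \<equiv> 2 * a + 4 * z * z * c"
  defines "h12 \<equiv> - y * uyz - z * a" and "h13 \<equiv> - y * uzz + y * a" and "h23 \<equiv> uyz - (1 - 2 * y * z * a) / 2"
  shows "y * y * uzz * (f2*f2 + f3*f3) + uyy * (f1*f1 + f3*f3) + uzz * (f1*f1 + f2*f2)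
      - 2 * (h12 * (f1 * f2) + h13 * (f1 * f3) + h23 * (f2 * f3)) < 0" (is "?Q < 0")
    and "f1 > 0"
proof -
  have q0: "q > 0" using q by simp
  define al ga be where "al = y\<^sup>2 / q" and "ga = z\<^sup>2 / q" and "be = y * z / q"
  have al: "0 \<le> al" "al \<le> 1" "0 \<le> ga" using q0 q(1) by (auto simp: al_def ga_def)
  have "2 * \<bar>y * z\<bar> \<le> q"
    unfolding q(1) using sum_squares_bound[of "\<bar>y\<bar>" "\<bar>z\<bar>"] by (simp add: abs_mult)
  then have be: "\<bar>be\<bar> \<le> 1/2" using q0 by (simp add: be_def field_simps)
  have f1: "f1 = 1 - 2 * be * A" by (simp add: f1_def be_def a_def)
  \<comment> \<open>The factor \<open>4 * a + 4 * q * c\<close> is \<open>uyy + uzz\<close>, the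
    flat Laplacian. It equals - 4 B / q: the contributions of A cancel because log q is harmonic,
    leaving only the concave correction.\<close>
  have Q: "?Q = 4 * q * a\<^sup>2 * y\<^sup>2 * (2 * a + 4 * z\<^sup>2 * c) + 8 * a ^ 3 * q + f1\<^sup>2 * (4 * a + 4 * q * c)
    + f1 * (8 * y * z * a\<^sup>2 + 16 * q * y * z * c * a) + f1 * (4 * y * z * a\<^sup>2)"
    unfolding f2_def f3_def uyy_def uyz_def uzz_def h12_def h13_def h23_def q(1) f1_def
    by (simp add: field_simps power2_eq_square power3_eq_cube)
  have yz: "y\<^sup>2 = al * q" "z\<^sup>2 = ga * q" "y * z = be * q" using q0 by (auto simp: al_def ga_def be_def)
  have "?Q = 4 * q * a\<^sup>2 * (al * q) * (2 * a + 4 * (ga * q) * c) + 8 * a ^ 3 * q + f1\<^sup>2 * (4 * a + 4 * q * c)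
    + f1 * (8 * (be * q) * a\<^sup>2 + 16 * q * (be * q) * c * a) + f1 * (4 * (be * q) * a\<^sup>2)"
    unfolding Q yz(1,2)[symmetric] yz(3)[symmetric] by (simp add: mult.assoc)
  also have "\<dots> = (1/q) * (4 * al * A\<^sup>2 * (2 * A - 4 * ga * (A + B)) + 8 * A ^ 3 * (1/q) - 4 * B * f1\<^sup>2
    - 8 * f1 * be * A * (A + 2 * B) + 4 * be * A\<^sup>2 * f1)"
    unfolding a_def c_def using q0 by (simp add: field_simps power2_eq_square power3_eq_cube)
  also have "\<dots> < 0"
    unfolding f1 using q0 q(2) barrier_bound_aux[OF al be _ _ AB, of "1/q"]
    by (intro mult_pos_neg) auto
  finally show "?Q < 0" .
  have A0: "0 \<le> A" using AB by simp
  have "\<bar>2 * be * A\<bar> \<le> 1 * (1/8)"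
    unfolding abs_mult using be AB A0 by (intro mult_mono) auto
  then show "f1 > 0" unfolding f1 by linarith
qed

text \<open>At a touching point the frame gradient is normal to the surface, so the traced Hessian
  is \<open>l\<^sup>2 * Q\<close> with \<open>Q < 0\<close>. This contradicts the nonnegativity
  given by \<open>minimal_jet_touch\<close>.\<close>

lemma barrier_no_touch:
  assumes jet: "minimal_jet U X Y Z" and p: "p \<in> U"
    and ke: "0 < k" "k \<le> 1/20" "0 < e" "e \<le> 1"
    and q: "1 \<le> nil_q (X p)" "e * ln (nil_q (X p)) \<le> 1"
  shows "\<not> (\<forall>\<^sub>F r in nhds p. nil_barrier k e (X p) \<le> nil_barrier k e (X r))"
proof
  assume min: "\<forall>\<^sub>F r in nhds p. nil_barrier k e (X p) \<le> nil_barrier k e (X r)"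
  define x where "x = X p"
  define q where "q = nil_q x"
  define A B where "A = k * e * (1 - e * ln q / 2)" and "B = k * e\<^sup>2 / 2"
  define a c where "a = A / q" and "c = - (A + B) / q\<^sup>2"
  have q1: "q \<ge> 1" using q by (simp add: q_def x_def)
  have w: "0 \<le> e * ln q" "e * ln q \<le> 1" using q q1 ke by (auto simp: q_def x_def)
  have ke': "0 < k * e" "k * e \<le> (1/20) * 1" using ke mult_mono[of k "1/20" e 1] by auto
  have A: "A \<le> k * e" "k * e / 2 \<le> A"
    unfolding A_def using w ke' mult_left_mono[of "1 - e * ln q / 2" 1 "k * e"] mult_left_mono[of "1/2" "1 - e * ln q / 2" "k * e"] by auto
  have B: "0 < B" "B \<le> k * e / 2"
    unfolding B_def power2_eq_square using ke by auto
  \<comment> \<open>The bound on \<open>k\<close> enters here: A^2 \<le> k^2 e^2 = 2 k B \<le> B /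
    10, so 20 A^2 \<le> 2 B < 3 B.\<close>
  have "A\<^sup>2 \<le> (k * e)\<^sup>2" using A ke' by (intro power_mono) auto
  also have "\<dots> = 2 * k * B" by (simp add: B_def power2_eq_square)
  also have "\<dots> \<le> 2 * (1/20) * B" using ke B by (intro mult_right_mono) auto
  finally have AB: "0 \<le> B" "B \<le> A" "A \<le> 1/8" "20 * A\<^sup>2 < 3 * B" using A B ke' by auto
  have slope: "barrier_slope k e q = a" by (simp add: barrier_slope_def a_def A_def)
  have S: "open {x. nil_q x > 0}"
    by (intro open_Collect_less continuous_intros) (auto simp: nil_q_def nil_z_def intro!: continuous_intros)
  have g': "(barrier_grad k e has_derivative barrier_hess a c (nil_z x) x) (at (X p))"
    using has_derivative_barrier_grad[of x k e] q1 
    unfolding q_def[symmetric] slope by (simp add: x_def[symmetric] c_def a_def B_def)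
  have g: "barrier_grad k e (X p) = vector [1 - x$2 * nil_z x * a, 2 * x$2 * a - x$1 * nil_z x * a, 2 * nil_z x * a]"
    unfolding barrier_grad_def Let_def x_def[symmetric] q_def[symmetric] slope ..
  note T = minimal_jet_touch[OF jet p S _ has_derivative_barrier g' min]
  have qx: "q = (x$2)\<^sup>2 + (nil_z x)\<^sup>2" by (simp add: q_def nil_q_def)
  define y z where "y = x$2" and "z = nil_z x"
  define f1 f2 f3 where f: "f1 = 1 - 2 * y * z * a" "f2 = 2 * y * a" "f3 = 2 * z * a"
  define uyy uyz uzz where u: "uyy = 2 * a + 4 * y * y * c" "uyz = 4 * y * z * c" "uzz = 2 * a + 4 * z * z * c"
  define h11 h12 h13 h23 where h: "h11 = y * y * uzz" "h12 = - y * uyz - z * a" "h13 = - y * uzz + y * a"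
    "h23 = uyz - (1 - 2 * y * z * a) / 2"
  define H where "H = (\<lambda>v1 v2 v3 w1 w2 w3. h11 * (v1 * w1) + uyy * (v2 * w2) + uzz * (v3 * w3)
     + h12 * (v1 * w2 + v2 * w1) + h13 * (v1 * w3 + v3 * w1) + h23 * (v2 * w3 + v3 * w2))"
  define Q where "Q = h11 * (f2*f2 + f3*f3) + uyy * (f1*f1 + f3*f3) + uzz * (f1*f1 + f2*f2)
      - 2 * (h12 * (f1 * f2) + h13 * (f1 * f3) + h23 * (f2 * f3))"
  have C: "Q < 0" "f1 > 0"
    unfolding Q_def h u f y_def z_def a_def c_def
    by (rule barrier_curvature_neg[OF qx q1 AB])+
  have orth: "f1 * Y i p $ 1 + f2 * Y i p $ 2 + f3 * nil_theta x (Y i p) = 0" for i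
  proof -
    have "barrier_grad k e (X p) \<bullet> Y i p = 0"
      by (rule T(1)) (use q1 in \<open>auto simp: q_def x_def\<close>)
    then show ?thesis unfolding g barrier_grad_frame f y_def z_def .
  qed
  have f1: "f1 \<noteq> 0" using C(2) by simp
  define l where "l = (Y 1 p $ 2 * nil_theta x (Y 2 p) - nil_theta x (Y 1 p) * Y 2 p $ 2) / f1"
  note O = trace_on_orthogonal_plane[OF orth[of 1] orth[of 2] f1, folded l_def]
  have "0 < nil_metric x (Y 1 p) (Y 1 p) * nil_metric x (Y 2 p) (Y 2 p)
         - nil_metric x (Y 1 p) (Y 2 p) * nil_metric x (Y 1 p) (Y 2 p)"
    using minimal_jet_metric_pos(2)[OF jet p] by (simp add: x_def)
  \<comment> \<open>If \<open>l\<close> vanished, so would the cross product of the tangent vectors,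
    and with it the Gram determinant.\<close>
  then have "l \<noteq> 0"
    unfolding Gram_eq_cross O(2) by auto
  then have "0 < l\<^sup>2" by simp
  note neg = mult_pos_neg[OF this C(1)]
  have Hf: "barrier_hess a c (nil_z x) x v \<bullet> w - barrier_grad k e x \<bullet> nil_conn x v w
      = H (v$1) (v$2) (nil_theta x v) (w$1) (w$2) (nil_theta x w)" for v w
    unfolding g[folded x_def] H_def h u y_def z_def by (rule barrier_hess_frame)
  have "0 \<le> nil_metric x (Y 2 p) (Y 2 p) * (barrier_hess a c (nil_z x) x (Y 1 p) \<bullet> Y 1 p - barrier_grad k e x \<bullet> nil_conn x (Y 1 p) (Y 1 p))
    - nil_metric x (Y 1 p) (Y 2 p) * ((barrier_hess a c (nil_z x) x (Y 1 p) \<bullet> Y 2 p - barrier_grad k e x \<bullet> nil_conn x (Y 1 p) (Y 2 p))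
     + (barrier_hess a c (nil_z x) x (Y 2 p) \<bullet> Y 1 p - barrier_grad k e x \<bullet> nil_conn x (Y 2 p) (Y 1 p)))
    + nil_metric x (Y 1 p) (Y 1 p) * (barrier_hess a c (nil_z x) x (Y 2 p) \<bullet> Y 2 p - barrier_grad k e x \<bullet> nil_conn x (Y 2 p) (Y 2 p))"
    by (rule T(2)[folded x_def]) (use q1 in \<open>auto simp: q_def\<close>)
  also have "\<dots> = l\<^sup>2 * Q"
    unfolding Hf H_def Q_def nil_metric_def by (rule O(1))
  finally show False using neg by linarith
qed

section \<open>The strong minimum principle\<close>

text \<open>Cayley-Hamilton: tr(A) A - det(A) I = A^2 is positive semidefinite.\<close>
lemma elliptic_lower_bound:
  fixes a11 a12 a22 s t :: real
  shows "(a11 * a22 - a12 * a12) * (s * s + t * t)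
    \<le> (a11 + a22) * (a11 * s * s + 2 * a12 * s * t + a22 * t * t)"
proof -
  have "(a11 + a22) * (a11 * s * s + 2 * a12 * s * t + a22 * t * t) - (a11 * a22 - a12 * a12) * (s * s + t * t)
    = (a11 * s + a12 * t)\<^sup>2 + (a12 * s + a22 * t)\<^sup>2"
    by (simp add: algebra_simps power2_eq_square)
  then show ?thesis by (smt (verit) zero_le_power2)
qed

lemma norm_vec2: "(norm (x :: real^2))\<^sup>2 = x$1 * x$1 + x$2 * x$2"
  by (simp add: power2_norm_eq_inner inner_vec_def sum_2)

text \<open>The Gaussian centred at \<open>q\<close> is the comparison function of Hopf's argument
  below.\<close>

lemma has_derivative_gauss:
  fixes q :: "real^2"
  defines "r \<equiv> \<lambda>x::real^2. (x$1 - q$1) * (x$1 - q$1) + (x$2 - q$2) * (x$2 - q$2)"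
  shows "((\<lambda>x. exp (- al * r x)) has_derivative
     (\<lambda>h. h$1 * (- 2 * al * (x$1 - q$1) * exp (- al * r x)) + h$2 * (- 2 * al * (x$2 - q$2) * exp (- al * r x)))) (at x)"
proof -
  have n: "((\<lambda>x. x $ i - q $ i) has_derivative (\<lambda>h. h $ i)) (at x)" for i
    using has_derivative_diff[OF has_derivative_nth has_derivative_const] by simp
  have "(r has_derivative (\<lambda>h. 2 * (x$1 - q$1) * h$1 + 2 * (x$2 - q$2) * h$2)) (at x)"
    unfolding r_def
    by (rule has_derivative_eq_rhs[OF has_derivative_add[OF has_derivative_mult[OF n n] has_derivative_mult[OF n n]]])
      (simp add: fun_eq_iff algebra_simps)
  moreover have "((\<lambda>r. exp (- al * r)) has_derivative (\<lambda>h. (- al * exp (- al * r0)) * h)) (at r0)" for r0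
    unfolding has_field_derivative_def[symmetric] by (auto intro!: derivative_eq_intros)
  ultimately show ?thesis
    by (rule has_derivative_eq_rhs[OF has_derivative_compose]) (simp add: fun_eq_iff algebra_simps)
qed

lemma has_derivative_gauss_partial:
  fixes q :: "real^2"
  defines "r \<equiv> \<lambda>x::real^2. (x$1 - q$1) * (x$1 - q$1) + (x$2 - q$2) * (x$2 - q$2)"
  shows "((\<lambda>x. - 2 * al * (x$i - q$i) * exp (- al * r x)) has_derivative
     (\<lambda>h. h$1 * ((4 * al * al * (x$i - q$i) * (x$1 - q$1) - (if i = 1 then 2 * al else 0)) * exp (- al * r x))
        + h$2 * ((4 * al * al * (x$i - q$i) * (x$2 - q$2) - (if i = 2 then 2 * al else 0)) * exp (- al * r x)))) (at x)"
proof -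
  have n: "((\<lambda>x. - 2 * al * (x $ i - q $ i)) has_derivative (\<lambda>h. - 2 * al * h $ i)) (at x)"
    by (rule has_derivative_eq_rhs[OF has_derivative_mult_right[OF has_derivative_diff[OF has_derivative_nth has_derivative_const]]]) simp
  show ?thesis
    unfolding r_def
    by (rule has_derivative_eq_rhs[OF has_derivative_mult[OF n has_derivative_gauss[of al q x]]])
      (use exhaust_2[of i] in \<open>auto simp: fun_eq_iff algebra_simps\<close>)
qed

text \<open>Hopf's argument. If v is positive at some q near p0, let z be a nearest zero, at
  distance d, and subtract from v a small multiple of a Gaussian w that vanishes on the sphere of
  radius d about q. Since v is nonnegative on both sides of that sphere, the annulus can extend from
  d/2 to 2d: z is then interior and an interior minimum replaces the usual boundary derivative. For
  a steep Gaussian such a minimum contradicts the differential inequality.\<close>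

lemma strong_minimum_principle:
  fixes v :: "real^2 \<Rightarrow> real"
  assumes U: "open U" "p0 \<in> U"
    and v: "\<And>q. q \<in> U \<Longrightarrow> (v has_derivative (\<lambda>h. h$1 * v1 q + h$2 * v2 q)) (at q)"
    and v1: "\<And>q. q \<in> U \<Longrightarrow> (v1 has_derivative (\<lambda>h. h$1 * v11 q + h$2 * v12 q)) (at q)"
    and v2: "\<And>q. q \<in> U \<Longrightarrow> (v2 has_derivative (\<lambda>h. h$1 * v21 q + h$2 * v22 q)) (at q)"
    and a: "continuous_on U a11" "continuous_on U a12" "continuous_on U a22"
    and b: "continuous_on U b1" "continuous_on U b2"
    and ell: "\<And>q. q \<in> U \<Longrightarrow> a11 q > 0" "\<And>q. q \<in> U \<Longrightarrow> a11 q * a22 q - a12 q * a12 q > 0"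
    and eq: "\<And>q. q \<in> U \<Longrightarrow> a11 q * v11 q + a12 q * (v12 q + v21 q) + a22 q * v22 q \<le> b1 q * v1 q + b2 q * v2 q"
    and nonneg: "\<And>q. q \<in> U \<Longrightarrow> v q \<ge> 0" and zero: "v p0 = 0"
  shows "\<exists>r>0. ball p0 r \<subseteq> U \<and> (\<forall>q\<in>ball p0 r. v q = 0)"
proof -
  obtain R where R: "R > 0" "cball p0 R \<subseteq> U" using U open_contains_cball by blast
  \<comment> \<open>With q within r of p0 and d < r, the ball of radius 2d about q stays inside
    \<open>cball p0 R\<close>.\<close>
  define r where "r = R / 3"
  have r: "r > 0" using R by (simp add: r_def)
  have vc: "continuous_on U v"
    using v by (meson continuous_at_imp_continuous_on has_derivative_continuous)
  have "v q = 0" if q: "q \<in> ball p0 r" for q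
  proof (rule ccontr)
    assume "v q \<noteq> 0"
    \<comment> \<open>Radius 2r suffices: a point closer to q than d is within 2r of p0, so a zero
      there would belong to \<open>Zs\<close> and contradict the choice of z.\<close>
    define Zs where "Zs = {x \<in> cball p0 (2 * r). v x = 0}"
    have sub: "cball p0 (2 * r) \<subseteq> U" using R r by (auto simp: r_def subset_iff)
    have "closed Zs" unfolding Zs_def
      by (rule continuous_closed_preimage_constant) (use vc sub continuous_on_subset in auto)
    moreover have "p0 \<in> Zs" using zero r by (simp add: Zs_def)
    ultimately obtain z where z: "z \<in> Zs" "\<And>y. y \<in> Zs \<Longrightarrow> dist q z \<le> dist q y"
      using distance_attains_inf[of Zs q] by blast
    define d where "d = dist q z"
    have vz: "v z = 0" using z by (simp add: Zs_def)
    have d: "d > 0" using \<open>v q \<noteq> 0\<close> vz by (auto simp: d_def)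
    have dr: "d < r" using z(2)[OF \<open>p0 \<in> Zs\<close>] q by (simp add: d_def dist_commute)
    have inC: "x \<in> cball p0 R" if "dist q x \<le> 2 * d" for x
      using that q dr dist_triangle[of p0 x q] by (simp add: r_def)
    have inside: "v x > 0" if "dist q x < d" for x
    proof -
      have "dist p0 x \<le> 2 * r" using that q dr dist_triangle[of p0 x q] by simp
      then have "v x \<noteq> 0" using z(2)[of x] that by (auto simp: Zs_def d_def)
      moreover have "x \<in> U" using \<open>dist p0 x \<le> 2 * r\<close> sub by auto
      ultimately show ?thesis using nonneg[of x] by simp
    qed
    have C: "compact (cball p0 R)" "cball p0 R \<noteq> {}" using R by auto
    have a22: "a22 x > 0" if "x \<in> U" for x
    proof -
      have "a11 x * a22 x > 0" using ell(2)[OF that] zero_le_square[of "a12 x"] by linarith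
      then show ?thesis using ell(1)[OF that] by (simp add: zero_less_mult_iff)
    qed
    \<comment> \<open>Determinant over trace is a lower bound for the smaller eigenvalue; its
      minimum over the compact ball is a uniform ellipticity constant.\<close>
    have "continuous_on (cball p0 R) (\<lambda>x. (a11 x * a22 x - a12 x * a12 x) / (a11 x + a22 x))"
      by (intro continuous_intros; (rule continuous_on_subset[OF _ R(2)] a)?)
        (use a R ell(1) a22 in \<open>fastforce simp: add_pos_pos subset_iff less_imp_neq[symmetric]\<close>)+
    then obtain x0 where x0: "x0 \<in> cball p0 R" "\<And>x. x \<in> cball p0 R \<Longrightarrow>
        (a11 x0 * a22 x0 - a12 x0 * a12 x0) / (a11 x0 + a22 x0) \<le> (a11 x * a22 x - a12 x * a12 x) / (a11 x + a22 x)"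
      using continuous_attains_inf[OF C] by blast
    define l where "l = (a11 x0 * a22 x0 - a12 x0 * a12 x0) / (a11 x0 + a22 x0)"
    have l: "l > 0" unfolding l_def using x0(1) R ell a22 by (auto intro!: divide_pos_pos add_pos_pos)
    have lower: "l * (s * s + t * t) \<le> a11 x * s * s + 2 * a12 x * s * t + a22 x * t * t" if "x \<in> cball p0 R" for x s t
    proof -
      have xU: "x \<in> U" using that R by auto
      have pos: "a11 x + a22 x > 0" using ell(1)[OF xU] a22[OF xU] by simp
      have "l * (s * s + t * t) \<le> (a11 x * a22 x - a12 x * a12 x) / (a11 x + a22 x) * (s * s + t * t)"
        using x0(2)[OF that] unfolding l_def by (intro mult_right_mono) auto
      also have "\<dots> \<le> a11 x * s * s + 2 * a12 x * s * t + a22 x * t * t"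
        using elliptic_lower_bound[of "a11 x" "a22 x" "a12 x" s t] pos by (simp add: divide_le_eq mult.commute)
      finally show ?thesis .
    qed
    have "continuous_on (cball p0 R) (\<lambda>x. a11 x + a22 x + \<bar>b1 x\<bar> + \<bar>b2 x\<bar>)"
      by (intro continuous_intros continuous_on_subset[OF _ R(2)] a b)
    then obtain x1 where x1: "x1 \<in> cball p0 R" "\<And>x. x \<in> cball p0 R \<Longrightarrow>
        a11 x + a22 x + \<bar>b1 x\<bar> + \<bar>b2 x\<bar> \<le> a11 x1 + a22 x1 + \<bar>b1 x1\<bar> + \<bar>b2 x1\<bar>"
      using continuous_attains_sup[OF C] by blast
    define m where "m = a11 x1 + a22 x1 + \<bar>b1 x1\<bar> + \<bar>b2 x1\<bar>"
    have "x1 \<in> U" using x1(1) R by blast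
    then have m: "m > 0" using ell(1)[of x1] a22[of x1] unfolding m_def by linarith
    \<comment> \<open>Chosen so that 2 al l d^2 / 4 = m + 2 m d + 1: this exceeds the trace of the
      coefficients (at most m) together with the first-order terms (at most 2 m d on the
      annulus).\<close>
    define al where "al = (2 * (m + 2 * m * d) + 2) / (l * d\<^sup>2)"
    have al: "al > 0" using m d l by (auto simp: al_def intro!: divide_pos_pos add_pos_pos)
    define \<rho> where "\<rho> = (\<lambda>x::real^2. (x$1 - q$1) * (x$1 - q$1) + (x$2 - q$2) * (x$2 - q$2))"
    have \<rho>: "\<rho> x = (dist q x)\<^sup>2" for x
      by (simp add: \<rho>_def dist_norm norm_minus_commute[of q] norm_vec2)
    define w where "w = (\<lambda>x. exp (- al * \<rho> x) - exp (- al * d\<^sup>2))"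
    have "sphere q (d/2) \<subseteq> U"
      using inC R d by (auto simp: subset_iff)
    moreover have "sphere q (d/2) \<noteq> {}" using d by simp
    ultimately obtain y where y: "y \<in> sphere q (d/2)" "\<And>x. x \<in> sphere q (d/2) \<Longrightarrow> v y \<le> v x"
      using continuous_attains_inf[of "sphere q (d/2)" v] continuous_on_subset[OF vc] by auto
    have vy: "v y > 0" using inside[of y] y(1) d by simp
    \<comment> \<open>As w < 1, this keeps v - e w positive on the inner sphere, where v is at least
      \<open>v y\<close>. On the outer sphere w is negative, so v - e w is positive there
      too.\<close>
    define e where "e = v y / 2"
    have e: "e > 0" using vy by (simp add: e_def)
    define g where "g = (\<lambda>x. v x - e * w x)"
    define K where "K = {x. d/2 \<le> dist q x \<and> dist q x \<le> 2 * d}"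
    have KC: "K \<subseteq> cball p0 R" using inC by (auto simp: K_def)
    have "closed K" unfolding K_def
      by (intro closed_Collect_conj closed_Collect_le continuous_intros)
    then have "compact K" using KC compact_cball[of p0 R] by (metis compact_Int_closed inf.absorb_iff2)
    have "continuous_on K g"
      unfolding g_def w_def \<rho>_def using KC R continuous_on_subset[OF vc, of K] by (auto intro!: continuous_intros)
    moreover have zK: "z \<in> K" using d by (simp add: K_def d_def)
    ultimately obtain x where x: "x \<in> K" "\<And>y. y \<in> K \<Longrightarrow> g x \<le> g y"
      using continuous_attains_inf[OF \<open>compact K\<close>, of g] by blast
    have "g z = 0" using vz by (simp add: g_def w_def \<rho> d_def)
    then have gx: "g x \<le> 0" using x(2)[OF zK] by simp
    have xC: "x \<in> cball p0 R" using x KC by blast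
    have xU: "x \<in> U" using xC R by blast
    have "dist q x \<noteq> d / 2"
    proof
      assume "dist q x = d / 2"
      then have "v y \<le> v x" using y(2) by simp
      moreover have "w x < 1" using al unfolding w_def \<rho>
        by (smt (verit) exp_gt_zero exp_le_one_iff mult_nonneg_nonneg zero_le_power2 mult_minus_left)
      ultimately have "g x > 0" using e by (simp add: g_def e_def) (smt (verit) mult_less_cancel_left2 vy field_sum_of_halves)
      then show False using gx by simp
    qed
    moreover have "dist q x \<noteq> 2 * d"
    proof
      assume *: "dist q x = 2 * d"
      have "w x < 0" using al d unfolding w_def \<rho> * by (simp add: power_mult_distrib)
      then have "g x > 0" using nonneg[OF xU] e by (simp add: g_def) (smt (verit) mult_pos_neg)
      then show False using gx by simp
    qed
    ultimately have xi: "d / 2 < dist q x" "dist q x < 2 * d" using x(1) by (auto simp: K_def)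
    define N where "N = {x. d / 2 < dist q x \<and> dist q x < 2 * d}"
    have N: "open N" "x \<in> N" "N \<subseteq> K" unfolding N_def K_def using xi
      by (auto intro!: open_Collect_conj open_Collect_less continuous_intros)
    have NU: "N \<subseteq> U" using N KC R by blast
    have min: "\<forall>\<^sub>F y in nhds x. g x \<le> g y"
      using eventually_nhds_in_open[OF N(1,2)] by eventually_elim (use x N in auto)
    define E where "E = exp (- al * \<rho> x)"
    define s t where "s = x$1 - q$1" and "t = x$2 - q$2"
    define w1 w2 where "w1 = (\<lambda>x. - 2 * al * (x$1 - q$1) * exp (- al * \<rho> x))"
      and "w2 = (\<lambda>x. - 2 * al * (x$2 - q$2) * exp (- al * \<rho> x))"
    have gd: "(g has_derivative (\<lambda>h. h$1 * (v1 y - e * w1 y) + h$2 * (v2 y - e * w2 y))) (at y)" if "y \<in> N" for y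
    proof -
      have "(w has_derivative (\<lambda>h. h$1 * w1 y + h$2 * w2 y)) (at y)"
        unfolding w_def w1_def w2_def \<rho>_def
        by (rule has_derivative_eq_rhs[OF has_derivative_diff[OF has_derivative_gauss[of al q y] has_derivative_const]]) simp
      from has_derivative_diff[OF v has_derivative_mult_right[OF this, of e]] that NU
      show ?thesis unfolding g_def
        by (rule_tac has_derivative_eq_rhs) (auto simp: fun_eq_iff algebra_simps)
    qed
    define w11 w12 w22 where "w11 = (4 * al * al * s * s - 2 * al) * E" and "w12 = 4 * al * al * s * t * E"
      and "w22 = (4 * al * al * t * t - 2 * al) * E"
    have g1: "((\<lambda>y. v1 y - e * w1 y) has_derivative (\<lambda>h. h$1 * (v11 x - e * w11) + h$2 * (v12 x - e * w12))) (at x)"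
    proof -
      have "(w1 has_derivative (\<lambda>h. h$1 * w11 + h$2 * w12)) (at x)"
        unfolding w1_def w11_def w12_def E_def s_def t_def \<rho>_def
        by (rule has_derivative_eq_rhs[OF has_derivative_gauss_partial[of al 1 q x]]) simp
      from has_derivative_diff[OF v1[OF xU] has_derivative_mult_right[OF this, of e]]
      show ?thesis
        by (rule has_derivative_eq_rhs) (auto simp: fun_eq_iff algebra_simps)
    qed
    have g2: "((\<lambda>y. v2 y - e * w2 y) has_derivative (\<lambda>h. h$1 * (v21 x - e * w12) + h$2 * (v22 x - e * w22))) (at x)"
    proof -
      have "(w2 has_derivative (\<lambda>h. h$1 * w12 + h$2 * w22)) (at x)"
        unfolding w2_def w22_def w12_def E_def s_def t_def \<rho>_def
        by (rule has_derivative_eq_rhs[OF has_derivative_gauss_partial[of al 2 q x]]) (simp add: algebra_simps)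
      from has_derivative_diff[OF v2[OF xU] has_derivative_mult_right[OF this, of e]]
      show ?thesis
        by (rule has_derivative_eq_rhs) (auto simp: fun_eq_iff algebra_simps)
    qed
    note L = local_min_along_line[OF N(1,2) gd g1 g2 min]
    \<comment> \<open>\<open>trace_nonneg_2\<close> contracts with a cofactor matrix, hence the
      exchanged diagonal entries and the sign of \<open>a12\<close>.\<close>
    have "a22 x * a11 x - (- a12 x) * (- a12 x) \<ge> 0" using ell(2)[OF xU] by (simp add: mult.commute)
    note T = trace_nonneg_2[OF L(3) a22[OF xU] this]
    have dv: "v1 x = e * w1 x" "v2 x = e * w2 x" using L(1,2) by auto
    have "e * (a11 x * w11 + 2 * a12 x * w12 + a22 x * w22)
        \<le> a11 x * v11 x + a12 x * (v12 x + v21 x) + a22 x * v22 x"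
      using T by (simp add: algebra_simps)
    also have "\<dots> \<le> e * (b1 x * w1 x + b2 x * w2 x)"
      using eq[OF xU] unfolding dv by (simp add: algebra_simps)
    finally have "a11 x * w11 + 2 * a12 x * w12 + a22 x * w22 \<le> b1 x * w1 x + b2 x * w2 x"
      using e by simp
    moreover have "a11 x * w11 + 2 * a12 x * w12 + a22 x * w22 = (2 * al * E) *
        (2 * al * (a11 x * s * s + 2 * a12 x * s * t + a22 x * t * t) - (a11 x + a22 x))"
      by (simp add: w11_def w12_def w22_def algebra_simps)
    moreover have "b1 x * w1 x + b2 x * w2 x = (2 * al * E) * (- (b1 x * s + b2 x * t))"
      by (simp add: w1_def w2_def E_def s_def t_def algebra_simps)
    moreover have "2 * al * E > 0" using al by (simp add: E_def)
    ultimately have main: "2 * al * (a11 x * s * s + 2 * a12 x * s * t + a22 x * t * t) - (a11 x + a22 x) \<le> - (b1 x * s + b2 x * t)"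
      by (metis mult_le_cancel_left_pos)
    have st: "s * s + t * t = (dist q x)\<^sup>2" using \<rho>[of x] by (simp add: \<rho>_def s_def t_def)
    have "(d/2)\<^sup>2 \<le> (dist q x)\<^sup>2" using xi d by (intro power_mono) auto
    then have "l * (d\<^sup>2 / 4) \<le> l * (s * s + t * t)" using l unfolding st by (simp add: power_divide)
    also note lower[OF xC]
    finally have al1: "2 * al * (l * (d\<^sup>2 / 4)) \<le> 2 * al * (a11 x * s * s + 2 * a12 x * s * t + a22 x * t * t)"
      using al by simp
    have al2: "2 * al * (l * (d\<^sup>2 / 4)) = m + 2 * m * d + 1"
      using l d by (simp add: al_def field_simps)
    have mx: "a11 x + a22 x + \<bar>b1 x\<bar> + \<bar>b2 x\<bar> \<le> m" using x1(2)[OF xC] by (simp add: m_def)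
    have "\<bar>s\<bar> \<le> 2 * d" "\<bar>t\<bar> \<le> 2 * d"
      using component_le_norm_cart[of "x - q" 1] component_le_norm_cart[of "x - q" 2] xi
      by (auto simp: s_def t_def dist_norm norm_minus_commute)
    then have "\<bar>b1 x\<bar> * \<bar>s\<bar> + \<bar>b2 x\<bar> * \<bar>t\<bar> \<le> \<bar>b1 x\<bar> * (2 * d) + \<bar>b2 x\<bar> * (2 * d)"
      by (intro add_mono mult_left_mono) auto
    also have "\<dots> = (\<bar>b1 x\<bar> + \<bar>b2 x\<bar>) * (2 * d)" by (simp add: algebra_simps)
    also have "\<dots> \<le> m * (2 * d)"
      using mx ell(1)[OF xU] a22[OF xU] d by (intro mult_right_mono) auto
    finally have "- (b1 x * s + b2 x * t) \<le> 2 * m * d"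
      using abs_ge_minus_self[of "b1 x * s"] abs_ge_minus_self[of "b2 x * t"] by (simp add: abs_mult)
    then show False using main mx al1 al2 ell(1)[OF xU] a22[OF xU] by linarith
  qed
  moreover have "ball p0 r \<subseteq> U" using R r by (auto simp: r_def subset_iff)
  ultimately show ?thesis using r by blast
qed

section \<open>The first coordinate of a minimal surface near its minimum\<close>

lemma minimal_jet_partial:
  assumes "minimal_jet U X Y Z" "p \<in> U"
  shows "((\<lambda>q. X q $ i) has_derivative (\<lambda>h. h$1 * Y 1 p $ i + h$2 * Y 2 p $ i)) (at p)"
    and "((\<lambda>q. Y a q $ i) has_derivative (\<lambda>h. h$1 * Z a 1 p $ i + h$2 * Z a 2 p $ i)) (at p)"
proof -
  note J = assms(1)[unfolded minimal_jet_def]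
  have "(X has_derivative (\<lambda>h. \<Sum>a\<in>UNIV. h$a *\<^sub>R Y a p)) (at p)" using J assms(2) by blast
  from has_derivative_compose[OF this has_derivative_nth]
  show "((\<lambda>q. X q $ i) has_derivative (\<lambda>h. h$1 * Y 1 p $ i + h$2 * Y 2 p $ i)) (at p)"
    by (simp add: sum_2)
  have "(Y a has_derivative (\<lambda>h. \<Sum>b\<in>UNIV. h$b *\<^sub>R Z a b p)) (at p)" using J assms(2) by blast
  from has_derivative_compose[OF this has_derivative_nth]
  show "((\<lambda>q. Y a q $ i) has_derivative (\<lambda>h. h$1 * Z a 1 p $ i + h$2 * Z a 2 p $ i)) (at p)"
    by (simp add: sum_2)
qed

lemma minimal_jet_continuous:
  assumes "minimal_jet U X Y Z"
  shows "continuous_on U X" "continuous_on U (Y a)" "continuous_on U (Z a b)"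
  using assms unfolding minimal_jet_def
  by (meson continuous_at_imp_continuous_on has_derivative_continuous)+

text \<open>The first component of the minimal surface equation is a linear elliptic equation for
  the first coordinate minus c, to which the strong minimum principle applies.\<close>

lemma minimal_jet_first_coordinate_min:
  assumes jet: "minimal_jet U X Y Z" and c: "\<And>p. p \<in> U \<Longrightarrow> c \<le> X p $ 1"
    and p0: "p0 \<in> U" "X p0 $ 1 = c"
  shows "\<exists>r>0. ball p0 r \<subseteq> U \<and> (\<forall>q\<in>ball p0 r. X q $ 1 = c)"
proof -
  define m where "m = (\<lambda>a b p. nil_metric (X p) (Y a p) (Y b p))"
  define D where "D = (\<lambda>p. m 1 1 p * m 2 2 p - m 1 2 p * m 1 2 p)"
  define T where "T = (\<lambda>p. m 2 2 p *\<^sub>R (Z 1 1 p + nil_conn (X p) (Y 1 p) (Y 1 p))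
     - m 1 2 p *\<^sub>R (Z 1 2 p + nil_conn (X p) (Y 1 p) (Y 2 p))
     - m 1 2 p *\<^sub>R (Z 2 1 p + nil_conn (X p) (Y 2 p) (Y 1 p))
     + m 1 1 p *\<^sub>R (Z 2 2 p + nil_conn (X p) (Y 2 p) (Y 2 p)))"
  \<comment> \<open>The tangential coefficients exist only pointwise in \<open>minimal_jet\<close>.
    Cramer's rule on the inner products of \<open>T\<close> with both tangent vectors recovers them
    as continuous functions.\<close>
  define k1 k2 where "k1 = (\<lambda>p. (m 2 2 p * nil_metric (X p) (T p) (Y 1 p) - m 1 2 p * nil_metric (X p) (T p) (Y 2 p)) / D p)"
    and "k2 = (\<lambda>p. (m 1 1 p * nil_metric (X p) (T p) (Y 2 p) - m 1 2 p * nil_metric (X p) (T p) (Y 1 p)) / D p)"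
  define th where "th = (\<lambda>a p. nil_theta (X p) (Y a p))"
  define n3 where "n3 = (\<lambda>p. Y 1 p $ 1 * Y 2 p $ 2 - Y 1 p $ 2 * Y 2 p $ 1)"
  note cont = minimal_jet_continuous[OF jet]
  have cX: "continuous_on U (\<lambda>p. X p $ i)" for i using cont(1) by (intro continuous_intros)
  have cY: "continuous_on U (\<lambda>p. Y a p $ i)" for a i using cont(2)[of a] by (intro continuous_intros)
  have cZ: "continuous_on U (\<lambda>p. Z a b p $ i)" for a b i using cont(3)[of a b] by (intro continuous_intros)
  have cth: "continuous_on U (\<lambda>p. nil_theta (X p) (Y a p))" for a
    unfolding nil_theta_def by (intro continuous_on_add continuous_on_diff continuous_on_mult continuous_on_divide continuous_on_const cX cY) simp
  have ct: "continuous_on U (th a)" for a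
    unfolding th_def by (rule cth)
  have cm: "continuous_on U (m a b)" for a b
    unfolding m_def nil_metric_def by (intro continuous_on_add continuous_on_mult cth cY)
  have cG: "continuous_on U (\<lambda>p. nil_conn (X p) (Y a p) (Y b p) $ i)" for a b i
  proof -
    have 1: "continuous_on U (\<lambda>p. nil_conn (X p) (Y a p) (Y b p) $ 1)"
      unfolding nil_conn_def Let_def vector_3
      by (intro continuous_on_add continuous_on_mult continuous_on_divide continuous_on_const cth cY) simp
    have 2: "continuous_on U (\<lambda>p. nil_conn (X p) (Y a p) (Y b p) $ 2)"
      unfolding nil_conn_def Let_def vector_3
      by (intro continuous_on_add continuous_on_minus continuous_on_mult continuous_on_divide continuous_on_const cth cY) simp
    have "continuous_on U (\<lambda>p. nil_conn (X p) (Y a p) (Y b p) $ 3)"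
      unfolding nil_conn_def Let_def vector_3
      by (intro continuous_on_add continuous_on_minus continuous_on_diff continuous_on_mult continuous_on_divide continuous_on_const cth cX cY) simp_all
    with 1 2 show ?thesis using exhaust_3[of i] by auto
  qed
  have cT: "continuous_on U (\<lambda>p. T p $ i)" for i
    unfolding T_def vector_add_component vector_minus_component vector_scaleR_component real_scaleR_def
    by (intro continuous_on_add continuous_on_diff continuous_on_mult cm cZ cG)
  have cTY: "continuous_on U (\<lambda>p. nil_metric (X p) (T p) (Y a p))" for a
    unfolding nil_metric_def nil_theta_def
    by (intro continuous_on_add continuous_on_diff continuous_on_mult continuous_on_divide continuous_on_const cT cX cY) simp_all
  have Dpos: "D p > 0" "m 1 1 p > 0" if "p \<in> U" for p
    using minimal_jet_metric_pos[OF jet that] by (auto simp: D_def m_def)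
  have m22: "m 2 2 p > 0" if "p \<in> U" for p
  proof -
    have "m 1 1 p * m 2 2 p > 0" using Dpos(1)[OF that] zero_le_square[of "m 1 2 p"] unfolding D_def by linarith
    then show ?thesis using Dpos(2)[OF that] by (simp add: zero_less_mult_iff)
  qed
  have cD: "continuous_on U D" unfolding D_def by (intro continuous_on_diff continuous_on_mult cm)
  have ck: "continuous_on U k1" "continuous_on U k2"
    unfolding k1_def k2_def
    by (intro continuous_on_divide continuous_on_diff continuous_on_mult cm cTY cD; use Dpos(1) in force)+
  have "\<exists>r>0. ball p0 r \<subseteq> U \<and> (\<forall>q\<in>ball p0 r. X q $ 1 - c = 0)"
  proof (rule strong_minimum_principle[where ?v1.0 = "\<lambda>p. Y 1 p $ 1" and ?v2.0 = "\<lambda>p. Y 2 p $ 1"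
        and ?v11.0 = "\<lambda>p. Z 1 1 p $ 1" and ?v12.0 = "\<lambda>p. Z 1 2 p $ 1" and ?v21.0 = "\<lambda>p. Z 2 1 p $ 1" and ?v22.0 = "\<lambda>p. Z 2 2 p $ 1"
        and ?a11.0 = "m 2 2" and ?a12.0 = "\<lambda>p. - m 1 2 p" and ?a22.0 = "m 1 1"
        and ?b1.0 = "\<lambda>p. k1 p - n3 p * th 2 p" and ?b2.0 = "\<lambda>p. k2 p + n3 p * th 1 p"])
    show "open U" using jet unfolding minimal_jet_def by blast
    show "((\<lambda>q. X q $ 1 - c) has_derivative (\<lambda>h. h $ 1 * Y 1 q $ 1 + h $ 2 * Y 2 q $ 1)) (at q)" if "q \<in> U" for q
      using has_derivative_diff[OF minimal_jet_partial(1)[OF jet that] has_derivative_const] by simp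
    show "continuous_on U (\<lambda>p. k1 p - n3 p * th 2 p)" "continuous_on U (\<lambda>p. k2 p + n3 p * th 1 p)"
      unfolding n3_def by (intro continuous_on_add continuous_on_diff continuous_on_mult ck cY ct)+
    show "0 < m 2 2 q * m 1 1 q - - m 1 2 q * - m 1 2 q" if "q \<in> U" for q
      using Dpos(1)[OF that] by (simp add: D_def mult.commute)
    fix p assume p: "p \<in> U"
    obtain c1 c2 where cc: "T p = c1 *\<^sub>R Y 1 p + c2 *\<^sub>R Y 2 p"
      using jet p unfolding minimal_jet_def Let_def m_def T_def by blast
    have bil: "nil_metric (X p) (T p) w = c1 * nil_metric (X p) (Y 1 p) w + c2 * nil_metric (X p) (Y 2 p) w" for w
    proof -
      have "nil_theta (X p) (c1 *\<^sub>R Y 1 p + c2 *\<^sub>R Y 2 p) = c1 * th 1 p + c2 * th 2 p"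
        by (simp add: nil_theta_def th_def field_simps)
      then show ?thesis unfolding cc nil_metric_def by (simp add: th_def algebra_simps)
    qed
    have mf: "nil_metric (X p) (Y a p) (Y b p) = m a b p" for a b by (simp add: m_def)
    have sym: "m 2 1 p = m 1 2 p"
      by (simp add: m_def nil_metric_def mult.commute)
    have "m 2 2 p * nil_metric (X p) (T p) (Y 1 p) - m 1 2 p * nil_metric (X p) (T p) (Y 2 p) = c1 * D p"
      "m 1 1 p * nil_metric (X p) (T p) (Y 2 p) - m 1 2 p * nil_metric (X p) (T p) (Y 1 p) = c2 * D p"
      unfolding bil mf sym D_def by (simp_all add: algebra_simps)
    then have k: "k1 p = c1" "k2 p = c2" using Dpos(1)[OF p] by (auto simp: k1_def k2_def)
    have T1: "m 2 2 p * (Z 1 1 p $ 1 + th 1 p * Y 1 p $ 2)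
      - m 1 2 p * (Z 1 2 p $ 1 + (th 2 p * Y 1 p $ 2 + th 1 p * Y 2 p $ 2) / 2)
      - m 1 2 p * (Z 2 1 p $ 1 + (th 2 p * Y 1 p $ 2 + th 1 p * Y 2 p $ 2) / 2)
      + m 1 1 p * (Z 2 2 p $ 1 + th 2 p * Y 2 p $ 2) = c1 * Y 1 p $ 1 + c2 * Y 2 p $ 1"
      using arg_cong[OF cc, of "\<lambda>v. v $ 1"]
      by (simp add: T_def nil_conn_def Let_def th_def add.commute)
    have mm: "m a b p = Y a p $ 1 * Y b p $ 1 + Y a p $ 2 * Y b p $ 2 + th a p * th b p" for a b
      by (simp add: m_def th_def nil_metric_def)
    \<comment> \<open>The traced connection term is minus the product of the second and third
      entries of the cross product of the tangent vectors in the frame. The second entry is linear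
      in the derivatives of the first coordinate, so the term can join the first-order
      coefficients.\<close>
    have id: "m 2 2 p * (th 1 p * Y 1 p $ 2) - m 1 2 p * (th 2 p * Y 1 p $ 2 + th 1 p * Y 2 p $ 2)
        + m 1 1 p * (th 2 p * Y 2 p $ 2) = - (th 1 p * Y 2 p $ 1 - Y 1 p $ 1 * th 2 p) * n3 p"
      unfolding mm n3_def by (simp add: algebra_simps)
    have "m 2 2 p * Z 1 1 p $ 1 + - m 1 2 p * (Z 1 2 p $ 1 + Z 2 1 p $ 1) + m 1 1 p * Z 2 2 p $ 1
       = c1 * Y 1 p $ 1 + c2 * Y 2 p $ 1 - (m 2 2 p * (th 1 p * Y 1 p $ 2) - m 1 2 p * (th 2 p * Y 1 p $ 2 + th 1 p * Y 2 p $ 2)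
        + m 1 1 p * (th 2 p * Y 2 p $ 2))"
      using T1 by (simp add: field_simps)
    then show "m 2 2 p * Z 1 1 p $ 1 + - m 1 2 p * (Z 1 2 p $ 1 + Z 2 1 p $ 1) + m 1 1 p * Z 2 2 p $ 1
        \<le> (k1 p - n3 p * th 2 p) * Y 1 p $ 1 + (k2 p + n3 p * th 1 p) * Y 2 p $ 1"
      unfolding id k by (simp add: algebra_simps)
  next
    show "((\<lambda>p. Y 1 p $ 1) has_derivative (\<lambda>h. h $ 1 * Z 1 1 q $ 1 + h $ 2 * Z 1 2 q $ 1)) (at q)" if "q \<in> U" for q
      by (rule minimal_jet_partial(2)[OF jet that])
    show "((\<lambda>p. Y 2 p $ 1) has_derivative (\<lambda>h. h $ 1 * Z 2 1 q $ 1 + h $ 2 * Z 2 2 q $ 1)) (at q)" if "q \<in> U" for q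
      by (rule minimal_jet_partial(2)[OF jet that])
    show "continuous_on U (\<lambda>p. - m 1 2 p)" by (intro continuous_on_minus cm)
  qed (use p0 c m22 cm in auto)
  then show ?thesis by simp
qed

text \<open>Where the first coordinate is constant, its derivatives vanish and the Gram determinant
  reduces to the square of the Jacobian of the remaining two coordinates. The Jacobian is therefore
  nonzero and the projection is open at p.\<close>

lemma minimal_jet_projection_interior:
  assumes jet: "minimal_jet U X Y Z" and p: "p \<in> N" and N: "open N" "N \<subseteq> U"
    and c: "\<And>q. q \<in> N \<Longrightarrow> X q $ 1 = c"
  shows "(vector [X p $ 2, X p $ 3] :: real^2) \<in> interior ((\<lambda>q. vector [X q $ 2, X q $ 3]) ` N)"
proof -
  have pU: "p \<in> U" using p N by blast
  have eq: "vector [s, t] = s *\<^sub>R axis 1 1 + t *\<^sub>R (axis 2 1 :: real^2)" for s t :: real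
    by (simp add: vec_eq_iff forall_2 axis_def)
  \<comment> \<open>A locally constant function has a local minimum, so the first-order test gives
    vanishing derivatives.\<close>
  have "\<forall>\<^sub>F q in nhds p. X p $ 1 \<le> X q $ 1"
    using eventually_nhds_in_open[OF N(1) p] by eventually_elim (use c p in auto)
  note L = local_min_along_line(1,2)[OF N(1) p minimal_jet_partial(1)[OF jet]
      minimal_jet_partial(2)[OF jet pU, of 1] minimal_jet_partial(2)[OF jet pU, of 2] this]
  have Y0: "Y 1 p $ 1 = 0" "Y 2 p $ 1 = 0" using L N(2) by auto
  define d where "d = Y 1 p $ 2 * Y 2 p $ 3 - Y 1 p $ 3 * Y 2 p $ 2"
  have "Y 1 p $ 2 * nil_theta (X p) (Y 2 p) - nil_theta (X p) (Y 1 p) * Y 2 p $ 2 = d"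
    by (simp add: nil_theta_def d_def Y0 field_simps)
  then have d: "d \<noteq> 0"
    using minimal_jet_metric_pos(2)[OF jet pU] unfolding Gram_eq_cross Y0 by auto
  \<comment> \<open>The inverse of the derivative by Cramer's rule; it serves as the right inverse
    required by the open mapping theorem.\<close>
  let ?g = "\<lambda>k::real^2. vector [(k$1 * Y 2 p $ 3 - k$2 * Y 2 p $ 2) / d, (Y 1 p $ 2 * k$2 - Y 1 p $ 3 * k$1) / d] :: real^2"
  show ?thesis
  proof (rule sussmann_open_mapping[OF N(1) _ p, where T = N])
    show "continuous_on N (\<lambda>q. vector [X q $ 2, X q $ 3] :: real^2)"
      using continuous_on_subset[OF minimal_jet_continuous(1)[OF jet] N(2)]
      unfolding eq by (intro continuous_intros)
    show "((\<lambda>q. vector [X q $ 2, X q $ 3] :: real^2) has_derivative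
        (\<lambda>h. vector [h$1 * Y 1 p $ 2 + h$2 * Y 2 p $ 2, h$1 * Y 1 p $ 3 + h$2 * Y 2 p $ 3])) (at p)"
      unfolding eq by (intro has_derivative_add has_derivative_scaleR_left minimal_jet_partial(1)[OF jet pU])
    show "bounded_linear ?g"
      unfolding linear_conv_bounded_linear[symmetric]
      by (rule linearI) (auto simp: vec_eq_iff forall_2 algebra_simps add_divide_distrib diff_divide_distrib)
    show "(\<lambda>h. vector [h$1 * Y 1 p $ 2 + h$2 * Y 2 p $ 2, h$1 * Y 1 p $ 3 + h$2 * Y 2 p $ 3] :: real^2) \<circ> ?g = id"
      using d by (auto simp: fun_eq_iff vec_eq_iff forall_2 field_simps) (auto simp: d_def algebra_simps)
  qed (use p N in \<open>auto simp: interior_open\<close>)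
qed

section \<open>The half-space theorem\<close>

definition nil_rot :: "real \<Rightarrow> real \<Rightarrow> real^3 \<Rightarrow> real^3" where
  "nil_rot s t x = vector [s * x$1 + t * x$2, - t * x$1 + s * x$2, x$3]"

lemma linear_nil_rot: "linear (nil_rot s t)"
  by (rule linearI) (auto simp: nil_rot_def vec_eq_iff forall_3 algebra_simps)

text \<open>Besides the vertical component, the contact form contains only the planar area form,
  which rotations preserve.\<close>

lemma nil_theta_rot:
  assumes "s * s + t * t = 1"
  shows "nil_theta (nil_rot s t x) (nil_rot s t v) = nil_theta x v"
proof -
  have "(- t * x$1 + s * x$2) * (s * v$1 + t * v$2) - (s * x$1 + t * x$2) * (- t * v$1 + s * v$2)
    = (s * s + t * t) * (x$2 * v$1 - x$1 * v$2)" by (simp add: algebra_simps)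
  then show ?thesis using assms by (simp add: nil_theta_def nil_rot_def)
qed

lemma nil_metric_rot:
  assumes "s * s + t * t = 1"
  shows "nil_metric (nil_rot s t x) (nil_rot s t v) (nil_rot s t w) = nil_metric x v w"
proof -
  have "(s * v$1 + t * v$2) * (s * w$1 + t * w$2) + (- t * v$1 + s * v$2) * (- t * w$1 + s * w$2)
    = (s * s + t * t) * (v$1 * w$1 + v$2 * w$2)" by (simp add: algebra_simps)
  then show ?thesis unfolding nil_metric_def nil_theta_rot[OF assms] using assms by (simp add: nil_rot_def)
qed

text \<open>Rotations are isometries, and being linear they add no second-derivative term, so the
  connection term transforms like a vector.\<close>

lemma nil_conn_rot:
  assumes "s * s + t * t = 1"
  shows "nil_conn (nil_rot s t x) (nil_rot s t v) (nil_rot s t w) = nil_rot s t (nil_conn x v w)"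
proof -
  define tv tw where "tv = nil_theta x v" and "tw = nil_theta x w"
  have "nil_conn (nil_rot s t x) (nil_rot s t v) (nil_rot s t w) $ 3
    = (s * s + t * t) * nil_conn x v w $ 3"
    unfolding nil_conn_def Let_def nil_theta_rot[OF assms] tv_def[symmetric] tw_def[symmetric]
    by (simp add: nil_rot_def field_simps)
  then have "nil_conn (nil_rot s t x) (nil_rot s t v) (nil_rot s t w) $ 3 = nil_conn x v w $ 3"
    using assms by simp
  then show ?thesis
    unfolding vec_eq_iff forall_3 
    unfolding nil_conn_def Let_def nil_theta_rot[OF assms]
    by (simp add: nil_rot_def field_simps)
qed

lemma minimal_jet_rot:
  assumes jet: "minimal_jet U X Y Z" and st: "s * s + t * t = 1"
  shows "minimal_jet U (\<lambda>p. nil_rot s t (X p)) (\<lambda>a p. nil_rot s t (Y a p)) (\<lambda>a b p. nil_rot s t (Z a b p))"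
proof -
  let ?R = "nil_rot s t"
  have J: "\<forall>p\<in>U. (X has_derivative (\<lambda>h. \<Sum>a\<in>UNIV. h$a *\<^sub>R Y a p)) (at p)"
    "\<forall>a. \<forall>p\<in>U. (Y a has_derivative (\<lambda>h. \<Sum>b\<in>UNIV. h$b *\<^sub>R Z a b p)) (at p)"
    "open U" "\<And>a b. continuous_on U (Z a b)"
    using jet unfolding minimal_jet_def by blast+
  have R: "(?R has_derivative ?R) F" for F
    using linear_nil_rot linear_conv_bounded_linear by (blast intro: bounded_linear_imp_has_derivative)
  have Rc: "continuous_on S ?R" for S
    using linear_nil_rot linear_continuous_on linear_conv_bounded_linear by blast
  note lin = linear_sum[OF linear_nil_rot] linear_scale[OF linear_nil_rot]
  note lin' = linear_add[OF linear_nil_rot] linear_scale[OF linear_nil_rot] linear_diff[OF linear_nil_rot]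
  show ?thesis
    unfolding minimal_jet_def Let_def nil_metric_rot[OF st] nil_conn_rot[OF st]
  proof (intro conjI allI ballI)
    show "open U" using J by blast
    show "((\<lambda>p. ?R (X p)) has_derivative (\<lambda>h. \<Sum>a\<in>UNIV. h $ a *\<^sub>R ?R (Y a p))) (at p)" if "p \<in> U" for p
      by (rule has_derivative_eq_rhs[OF has_derivative_compose[OF J(1)[rule_format, OF that] R]]) (simp add: lin)
    show "((\<lambda>p. ?R (Y a p)) has_derivative (\<lambda>h. \<Sum>b\<in>UNIV. h $ b *\<^sub>R ?R (Z a b p))) (at p)" if "p \<in> U" for a p
      by (rule has_derivative_eq_rhs[OF has_derivative_compose[OF J(2)[rule_format, OF that] R]]) (simp add: lin)
    show "continuous_on U (\<lambda>p. ?R (Z a b p))" for a b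
      by (rule continuous_on_compose2[OF Rc[of UNIV]]) (use J in auto)
    fix p assume p: "p \<in> U"
    show "nil_metric (X p) (Y 1 p) (Y 1 p) * nil_metric (X p) (Y 2 p) (Y 2 p) -
      nil_metric (X p) (Y 1 p) (Y 2 p) * nil_metric (X p) (Y 1 p) (Y 2 p) \<noteq> 0"
      using jet p unfolding minimal_jet_def Let_def by blast
    obtain c1 c2 where c: "nil_metric (X p) (Y 2 p) (Y 2 p) *\<^sub>R (Z 1 1 p + nil_conn (X p) (Y 1 p) (Y 1 p))
      - nil_metric (X p) (Y 1 p) (Y 2 p) *\<^sub>R (Z 1 2 p + nil_conn (X p) (Y 1 p) (Y 2 p))
      - nil_metric (X p) (Y 1 p) (Y 2 p) *\<^sub>R (Z 2 1 p + nil_conn (X p) (Y 2 p) (Y 1 p))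
      + nil_metric (X p) (Y 1 p) (Y 1 p) *\<^sub>R (Z 2 2 p + nil_conn (X p) (Y 2 p) (Y 2 p))
      = c1 *\<^sub>R Y 1 p + c2 *\<^sub>R Y 2 p"
      using jet p unfolding minimal_jet_def Let_def by blast
    show "\<exists>c1 c2. nil_metric (X p) (Y 2 p) (Y 2 p) *\<^sub>R (?R (Z 1 1 p) + ?R (nil_conn (X p) (Y 1 p) (Y 1 p)))
      - nil_metric (X p) (Y 1 p) (Y 2 p) *\<^sub>R (?R (Z 1 2 p) + ?R (nil_conn (X p) (Y 1 p) (Y 2 p)))
      - nil_metric (X p) (Y 1 p) (Y 2 p) *\<^sub>R (?R (Z 2 1 p) + ?R (nil_conn (X p) (Y 2 p) (Y 1 p)))
      + nil_metric (X p) (Y 1 p) (Y 1 p) *\<^sub>R (?R (Z 2 2 p) + ?R (nil_conn (X p) (Y 2 p) (Y 2 p)))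
      = c1 *\<^sub>R ?R (Y 1 p) + c2 *\<^sub>R ?R (Y 2 p)"
      using arg_cong[OF c, of ?R] by (intro exI[of _ c1] exI[of _ c2]) (simp only: lin')
  qed
qed

section \<open>The gap below a surface that avoids a vertical plane\<close>

text \<open>A convergent sequence together with its limit is compact, so its trace on S is closed
  and contains the limit.\<close>

lemma closed_if_compact_Int:
  fixes S :: "'a::heine_borel set"
  assumes "\<And>K. compact K \<Longrightarrow> compact (S \<inter> K)"
  shows "closed S"
  unfolding closed_sequential_limits
proof (intro allI impI, elim conjE)
  fix x l assume x: "\<forall>n. x n \<in> S" "x \<longlonglongrightarrow> l"
  have "compact (insert l (range x))" using x(2) by (rule compact_sequence_with_limit)
  then have "closed (S \<inter> insert l (range x))" using assms compact_imp_closed by blast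
  then have "l \<in> S \<inter> insert l (range x)"
    by (rule closed_sequentially) (use x in auto)
  then show "l \<in> S" by blast
qed

lemma continuous_on_nil_q: "continuous_on S nil_q" "continuous_on S nil_z"
  unfolding nil_q_def nil_z_def by (auto intro!: continuous_intros)

text \<open>A bound on \<open>nil_q\<close> bounds the second coordinate and \<open>nil_z\<close>;
  with the first coordinate bounded too, the third one is recovered from
  \<open>nil_z\<close>.\<close>

lemma compact_slab:
  "compact {x. c \<le> x$1 \<and> x$1 \<le> c + 1 \<and> L \<le> nil_q x \<and> nil_q x \<le> R}" (is "compact ?K")
proof -
  have "closed ?K"
    by (intro closed_Collect_conj closed_Collect_le continuous_intros continuous_on_nil_q)
  moreover have "bounded ?K"
  proof (rule boundedI)
    fix x assume x: "x \<in> ?K"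
    have sq: "\<bar>t\<bar> \<le> R + 1" if "t\<^sup>2 \<le> R" for t :: real
    proof -
      have "0 \<le> (\<bar>t\<bar> - 1)\<^sup>2" by simp
      then have "2 * \<bar>t\<bar> \<le> t\<^sup>2 + 1" by (simp add: power2_diff)
      then show ?thesis using that by linarith
    qed
    have "(x$2)\<^sup>2 \<le> R" "(nil_z x)\<^sup>2 \<le> R"
      using x zero_le_power2[of "x$2"] zero_le_power2[of "nil_z x"] unfolding nil_q_def mem_Collect_eq by linarith+
    then have yz: "\<bar>x$2\<bar> \<le> R + 1" "\<bar>nil_z x\<bar> \<le> R + 1" using sq by auto
    have x1: "\<bar>x$1\<bar> \<le> \<bar>c\<bar> + 1" using x by auto
    have "\<bar>x$1 * x$2\<bar> \<le> (\<bar>c\<bar> + 1) * (R + 1)"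
      unfolding abs_mult using yz x1 by (intro mult_mono) auto
    then have "\<bar>x$3\<bar> \<le> (R + 1) + (\<bar>c\<bar> + 1) * (R + 1)"
      using yz(2) unfolding nil_z_def by linarith
    then show "norm x \<le> \<bar>c\<bar> + 1 + (R + 1) + ((R + 1) + (\<bar>c\<bar> + 1) * (R + 1))"
      using norm_le_l1_cart[of x] yz x1 unfolding sum_3 by linarith
  qed
  ultimately show ?thesis by (simp add: compact_eq_bounded_closed)
qed

lemma barrier_bounds:
  assumes "0 < k" "0 < e" "1 \<le> nil_q x" "e * ln (nil_q x) \<le> 1"
  shows "x$1 \<le> nil_barrier k e x" and "nil_barrier k e x \<le> x$1 + k * (e * ln (nil_q x))"
proof -
  define w where "w = e * ln (nil_q x)"
  have w: "0 \<le> w" "w \<le> 1" using assms by (auto simp: w_def)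
  have "w * w \<le> w * 1" using w by (intro mult_left_mono) auto
  then have "w\<^sup>2 \<le> w" by (simp add: power2_eq_square)
  then have "0 \<le> w - w\<^sup>2 / 4" "w - w\<^sup>2 / 4 \<le> w" using w by auto
  then have "0 \<le> k * (w - w\<^sup>2 / 4)" "k * (w - w\<^sup>2 / 4) \<le> k * w"
    using assms(1) by (auto intro!: mult_nonneg_nonneg mult_left_mono)
  then show "x$1 \<le> nil_barrier k e x" "nil_barrier k e x \<le> x$1 + k * (e * ln (nil_q x))"
    by (auto simp: nil_barrier_def w_def)
qed

lemma halfspace_gap:
  fixes S :: "(real^3) set"
  assumes comp: "\<And>K. compact K \<Longrightarrow> compact (S \<inter> K)"
    and jets: "\<And>x. x \<in> S \<Longrightarrow> \<exists>U X Y Z p. minimal_jet U X Y Z \<and> p \<in> U \<and> X p = x \<and> X ` U \<subseteq> S"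
    and above: "\<And>x. x \<in> S \<Longrightarrow> c < x$1"
  shows "\<exists>d>0. \<forall>x\<in>S. c + d \<le> x$1"
proof -
  have "\<exists>d>0. \<forall>x\<in>S. nil_q x \<le> 1 \<longrightarrow> c + d \<le> x$1"
  proof -
    define K where "K = S \<inter> {x. c \<le> x$1 \<and> x$1 \<le> c + 1 \<and> 0 \<le> nil_q x \<and> nil_q x \<le> 1}"
    have q0: "0 \<le> nil_q x" for x by (simp add: nil_q_def)
    have K: "compact K" unfolding K_def by (intro comp compact_slab)
    show ?thesis
    proof (cases "K = {}")
      case True
      have "c + 1 \<le> x$1" if "x \<in> S" "nil_q x \<le> 1" for x
        using True that above[OF that(1)] q0[of x] unfolding K_def by fastforce
      then show ?thesis by (intro exI[of _ 1]) auto
    next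
      case False
      have "continuous_on K (\<lambda>x. x$1)" by (intro continuous_intros)
      then obtain y where y: "y \<in> K" "\<And>x. x \<in> K \<Longrightarrow> y$1 \<le> x$1"
        using continuous_attains_inf[OF K False] by blast
      have "c + min 1 (y$1 - c) \<le> x$1" if "x \<in> S" "nil_q x \<le> 1" for x
      proof (cases "x$1 \<le> c + 1")
        case True
        then have "x \<in> K" using that above[OF that(1)] q0[of x] by (auto simp: K_def)
        then show ?thesis using y(2) by fastforce
      qed auto
      moreover have "0 < min 1 (y$1 - c)" using y(1) above by (auto simp: K_def)
      ultimately show ?thesis by blast
    qed
  qed
  then obtain d where d: "d > 0" "\<And>x. x \<in> S \<Longrightarrow> nil_q x \<le> 1 \<Longrightarrow> c + d \<le> x$1" by blast
  \<comment> \<open>At most 1/20 for \<open>barrier_no_touch\<close>, and at most d so that on q = 1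
    the barrier already exceeds the level c + 3k/4.\<close>
  define k where "k = min (1/20) d"
  have k: "0 < k" "k \<le> 1/20" "k \<le> d" using d by (auto simp: k_def)
  have claim: "c + 3/4 * k \<le> nil_barrier k e x0"
    if e: "0 < e" "e \<le> 1" and x0: "x0 \<in> S" "1 \<le> nil_q x0" "e * ln (nil_q x0) \<le> 1" for e x0
  proof (rule ccontr)
    assume neg: "\<not> c + 3/4 * k \<le> nil_barrier k e x0"
    have lnq: "nil_q x \<le> exp (1/e) \<longleftrightarrow> e * ln (nil_q x) \<le> 1" if "1 \<le> nil_q x" for x
    proof -
      have "nil_q x \<le> exp (1/e) \<longleftrightarrow> ln (nil_q x) \<le> 1 / e" using that by (subst ln_le_cancel_iff[symmetric]) auto
      then show ?thesis using e by (simp add: field_simps)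
    qed
    \<comment> \<open>Cutting at height c + 1 yields compactness at no cost: the barrier is at least
      the first coordinate, so a minimum below c + 3k/4 stays away from the cut.\<close>
    define K where "K = S \<inter> {x. c \<le> x$1 \<and> x$1 \<le> c + 1 \<and> 1 \<le> nil_q x \<and> nil_q x \<le> exp (1/e)}"
    have K: "compact K" unfolding K_def by (intro comp compact_slab)
    have "x0$1 \<le> nil_barrier k e x0" by (rule barrier_bounds(1)[OF k(1) e(1) x0(2,3)])
    then have "x0 \<in> K" using x0 neg k above[OF x0(1)] lnq[OF x0(2)] by (auto simp: K_def)
    moreover have "continuous_on K (nil_barrier k e)"
      unfolding nil_barrier_def K_def by (intro continuous_intros continuous_on_nil_q) auto
    ultimately obtain x where x: "x \<in> K" "\<And>y. y \<in> K \<Longrightarrow> nil_barrier k e x \<le> nil_barrier k e y"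
      using continuous_attains_inf[OF K] by blast
    have less: "nil_barrier k e x < c + 3/4 * k" using x(2)[OF \<open>x0 \<in> K\<close>] neg by simp
    have xS: "x \<in> S" and xq: "1 \<le> nil_q x" "e * ln (nil_q x) \<le> 1" using x(1) lnq by (auto simp: K_def)
    have "x$1 \<le> nil_barrier k e x" by (rule barrier_bounds(1)[OF k(1) e(1) xq])
    then have x1: "c < x$1" "x$1 < c + 1" using above[OF xS] less k by auto
    have "nil_q x \<noteq> 1"
    proof
      assume "nil_q x = 1"
      then have "c + d \<le> x$1" "nil_barrier k e x = x$1" using d(2)[OF xS] by (auto simp: nil_barrier_def)
      then show False using less k by linarith
    qed
    moreover have "nil_q x \<noteq> exp (1/e)"
    proof
      assume *: "nil_q x = exp (1/e)"
      have "e * ln (nil_q x) = 1" unfolding * using e by simp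
      then have "nil_barrier k e x = x$1 + 3/4 * k" by (simp add: nil_barrier_def)
      then show False using less x1 by linarith
    qed
    ultimately have q: "1 < nil_q x" "nil_q x < exp (1/e)" using x(1) by (auto simp: K_def)
    \<comment> \<open>All boundary cases have been excluded, so surface points near the minimum
      remain in \<open>K\<close> and the minimum is a local one on the surface.\<close>
    define N where "N = {x::real^3. c < x$1 \<and> x$1 < c + 1 \<and> 1 < nil_q x \<and> nil_q x < exp (1/e)}"
    have N: "open N" "x \<in> N"
      unfolding N_def using q x1
      by (auto intro!: open_Collect_conj open_Collect_less continuous_intros continuous_on_nil_q)
    obtain U X Y Z p where jet: "minimal_jet U X Y Z" and p: "p \<in> U" "X p = x" "X ` U \<subseteq> S"
      using jets[OF xS] by blast
    have "open U" using jet by (simp add: minimal_jet_def)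
    have "open (U \<inter> X -` N)"
      using continuous_open_preimage[OF minimal_jet_continuous(1)[OF jet] \<open>open U\<close> N(1)] .
    then have "\<forall>\<^sub>F r in nhds p. r \<in> U \<inter> X -` N"
      using p N by (intro eventually_nhds_in_open) auto
    then have "\<forall>\<^sub>F r in nhds p. nil_barrier k e (X p) \<le> nil_barrier k e (X r)"
    proof eventually_elim
      case (elim r)
      then have "X r \<in> K" using p(3) unfolding K_def N_def by fastforce
      then show ?case using x(2) p(2) by simp
    qed
    then show False
      using barrier_no_touch[OF jet p(1) k(1,2) e] xq p(2) by simp
  qed
  have "c + 3/4 * k \<le> x$1" if xS: "x \<in> S" for x
  proof (cases "nil_q x \<le> 1")
    case True
    then show ?thesis using d(2)[OF xS] k by auto
  next
    case False
    show ?thesis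
    proof (rule ccontr)
      assume neg: "\<not> c + 3/4 * k \<le> x$1"
      define l g where "l = ln (nil_q x)" and "g = c + 3/4 * k - x$1"
      have l: "l > 0" using False by (simp add: l_def)
      have g: "g > 0" using neg by (simp add: g_def)
      \<comment> \<open>The bound 1/l places x in the region of the claim; the other bound makes the
        correction at x at most half of the supposed deficit g.\<close>
      define e where "e = min 1 (min (1 / l) (g / (2 * k * l)))"
      have e: "0 < e" "e \<le> 1" using l g k by (auto simp: e_def)
      have "e \<le> 1 / l" "e \<le> g / (2 * k * l)" by (auto simp: e_def)
      then have el: "e * l \<le> 1" "k * (e * l) \<le> g / 2" using l k by (auto simp: field_simps)
      have "c + 3/4 * k \<le> nil_barrier k e x"
        by (rule claim[OF e xS]) (use False el in \<open>auto simp: l_def\<close>)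
      also have "\<dots> \<le> x$1 + k * (e * ln (nil_q x))"
        by (rule barrier_bounds(2)) (use k e False el in \<open>auto simp: l_def\<close>)
      finally show False using el(2) g by (simp add: l_def g_def)
    qed
  qed
  then show ?thesis using k by (intro exI[of _ "3/4 * k"]) auto
qed

section \<open>From the minimum of the first coordinate to the whole plane\<close>

text \<open>The charts carry jets rather than \<open>minimal_on\<close>, because jets are what the
  rotation of a general half-space supplies.\<close>

lemma halfspace_first_coordinate:
  fixes g :: "'a \<Rightarrow> real^3"
  assumes ne: "topspace M \<noteq> {}" and conn: "connected_space M" and cont: "continuous_map M euclidean g"
    and proper: "\<And>K. compact K \<Longrightarrow> compactin M {p \<in> topspace M. g p \<in> K}"
    and charts: "\<And>q. q \<in> topspace M \<Longrightarrow> \<exists>U V h Y Z. openin M V \<and> q \<in> V \<and>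
        homeomorphic_map (subtopology euclidean U) (subtopology M V) h \<and> minimal_jet U (g \<circ> h) Y Z"
    and b: "\<And>q. q \<in> topspace M \<Longrightarrow> b \<le> g q $ 1"
  shows "\<exists>c. g ` topspace M = {x. x$1 = c}"
proof -
  define S where "S = g ` topspace M"
  have comp: "compact (S \<inter> K)" if "compact K" for K
  proof -
    have "compactin euclidean (g ` {p \<in> topspace M. g p \<in> K})"
      by (rule image_compactin[OF proper[OF that] cont])
    moreover have "g ` {p \<in> topspace M. g p \<in> K} = S \<inter> K" by (auto simp: S_def)
    ultimately show ?thesis by simp
  qed
  have closed: "closed S" by (rule closed_if_compact_Int) (rule comp)
  have chart: "\<exists>U h Y Z p. minimal_jet U (g \<circ> h) Y Z \<and> p \<in> U \<and> h p = q \<and> h ` U \<subseteq> topspace M \<and>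
      (\<forall>N. open N \<and> N \<subseteq> U \<longrightarrow> openin M (h ` N))" if q: "q \<in> topspace M" for q
  proof -
    obtain U V h Y Z where V: "openin M V" "q \<in> V"
      and h: "homeomorphic_map (subtopology euclidean U) (subtopology M V) h" and jet: "minimal_jet U (g \<circ> h) Y Z"
      using charts[OF q] by blast
    have VM: "V \<subseteq> topspace M" using V openin_subset by blast
    have hU: "h ` U = V"
      using homeomorphic_imp_surjective_map[OF h] VM by (simp add: inf.absorb2)
    then obtain p where "p \<in> U" "h p = q" using V by blast
    moreover have "openin M (h ` N)" if "open N" "N \<subseteq> U" for N
    proof -
      have "openin (subtopology euclidean U) N"
        using that by (simp add: open_subset)
      then have "openin (subtopology M V) (h ` N)"
        using homeomorphic_imp_open_map[OF h] by (simp add: open_map_def)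
      then show ?thesis using V(1) openin_trans_full by blast
    qed
    moreover have "h ` U \<subseteq> topspace M" using hU VM by simp
    ultimately show ?thesis using jet
      by (intro exI[of _ U] exI[of _ h] exI[of _ Y] exI[of _ Z] exI[of _ p]) simp
  qed
  define c where "c = Inf ((\<lambda>x. x$1) ` S)"
  have bdd: "bdd_below ((\<lambda>x. x$1) ` S)" using b by (auto simp: S_def intro!: bdd_belowI[of _ b])
  have neS: "(\<lambda>x. x$1) ` S \<noteq> {}" using ne by (simp add: S_def)
  have above: "c \<le> g q $ 1" if "q \<in> topspace M" for q
    unfolding c_def using that by (intro cInf_lower bdd) (auto simp: S_def)
  have "\<exists>q\<in>topspace M. g q $ 1 = c"
  proof (rule ccontr)
    assume no: "\<not> (\<exists>q\<in>topspace M. g q $ 1 = c)"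
    have "\<exists>d>0. \<forall>x\<in>S. c + d \<le> x$1"
    proof (rule halfspace_gap[OF comp])
      fix x assume "x \<in> S"
      then obtain q where q: "q \<in> topspace M" "g q = x" by (auto simp: S_def)
      then show "c < x$1" using above[OF q(1)] no by (metis order_le_less)
      obtain U h Y Z p where u: "minimal_jet U (g \<circ> h) Y Z" "p \<in> U" "h p = q" "h ` U \<subseteq> topspace M"
        using chart[OF q(1)] by blast
      then show "\<exists>U X Y Z p. minimal_jet U X Y Z \<and> p \<in> U \<and> X p = x \<and> X ` U \<subseteq> S"
        using q by (intro exI[of _ U] exI[of _ "g \<circ> h"] exI[of _ Y] exI[of _ Z] exI[of _ p]) (auto simp: S_def)
    qed
    then obtain d where "d > 0" "\<And>x. x \<in> S \<Longrightarrow> c + d \<le> x$1" by blast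
    then have "c + d \<le> c" unfolding c_def by (intro cInf_greatest neS) (auto simp: c_def)
    then show False using \<open>d > 0\<close> by simp
  qed
  then obtain q0 where q0: "q0 \<in> topspace M" "g q0 $ 1 = c" by blast
  \<comment> \<open>This set is closed by continuity and open by the strong minimum principle, hence
    all of the connected surface.\<close>
  define T where "T = {q \<in> topspace M. g q \<in> {x. x$1 = c}}"
  have "closed {x::real^3. x$1 = c}"
    by (rule closed_Collect_eq) (rule continuous_on_component continuous_on_const continuous_on_id)+
  then have "closedin euclidean {x::real^3. x$1 = c}" by (simp only: closed_closedin)
  from closedin_continuous_map_preimage[OF cont this]
  have "closedin M T" unfolding T_def .
  moreover have "openin M T"
  proof (rule openin_subopen[THEN iffD2], intro ballI)
    fix q assume q: "q \<in> T"
    then have qM: "q \<in> topspace M" and gq: "g q $ 1 = c" by (auto simp: T_def)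
    obtain U h Y Z p where u: "minimal_jet U (g \<circ> h) Y Z" "p \<in> U" "h p = q" "h ` U \<subseteq> topspace M"
        "\<And>N. open N \<Longrightarrow> N \<subseteq> U \<Longrightarrow> openin M (h ` N)"
      using chart[OF qM] by auto
    have "c \<le> (g \<circ> h) s $ 1" if "s \<in> U" for s
      using above[of "h s"] u(4) that by auto
    moreover have "(g \<circ> h) p $ 1 = c" using u(3) gq by simp
    ultimately have "\<exists>r>0. ball p r \<subseteq> U \<and> (\<forall>s\<in>ball p r. (g \<circ> h) s $ 1 = c)"
      by (intro minimal_jet_first_coordinate_min[OF u(1) _ u(2)])
    then obtain r where r: "r > 0" "ball p r \<subseteq> U" "\<And>s. s \<in> ball p r \<Longrightarrow> (g \<circ> h) s $ 1 = c"
      by blast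
    have "openin M (h ` ball p r)" using u(5) r by simp
    moreover have "h p \<in> h ` ball p r" using r(1) by (intro imageI) simp
    moreover have "h ` ball p r \<subseteq> T"
    proof
      fix y assume "y \<in> h ` ball p r"
      then obtain s where "s \<in> ball p r" "y = h s" by blast
      moreover have "h s \<in> topspace M" using calculation(1) r(2) u(4) by blast
      ultimately show "y \<in> T" using r(3)[of s] by (simp add: T_def)
    qed
    ultimately show "\<exists>W. openin M W \<and> q \<in> W \<and> W \<subseteq> T" unfolding u(3) by blast
  qed
  moreover have "T \<noteq> {}" using q0 by (auto simp: T_def)
  ultimately have "T = topspace M" using conn unfolding connected_space_clopen_in by blast
  then have flat: "g q $ 1 = c" if "q \<in> topspace M" for q using that by (auto simp: T_def)
  \<comment> \<open>The surface now lies in one plane; this chart of the plane turns the remaining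
    surjectivity into a clopen argument in the Euclidean plane.\<close>
  define \<pi> where "\<pi> = (\<lambda>x::real^3. vector [x$2, x$3] :: real^2)"
  have op: "open (\<pi> ` S)"
  proof (rule open_subopen[THEN iffD2], intro ballI)
    fix w assume "w \<in> \<pi> ` S"
    then obtain q where q: "q \<in> topspace M" "w = \<pi> (g q)" by (auto simp: S_def)
    obtain U h Y Z p where u: "minimal_jet U (g \<circ> h) Y Z" "p \<in> U" "h p = q" "h ` U \<subseteq> topspace M"
      using chart[OF q(1)] by blast
    have "open U" using u(1) by (simp add: minimal_jet_def)
    have "\<pi> ((g \<circ> h) p) \<in> interior ((\<lambda>s. \<pi> ((g \<circ> h) s)) ` U)"
      unfolding \<pi>_def
      by (rule minimal_jet_projection_interior[OF u(1,2) \<open>open U\<close>]) (use u flat in auto)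
    moreover have "\<pi> ((g \<circ> h) p) = w" using q(2) u(3) by simp
    moreover have "(\<lambda>s. \<pi> ((g \<circ> h) s)) ` U \<subseteq> \<pi> ` S" using u(4) by (auto simp: S_def)
    then have "interior ((\<lambda>s. \<pi> ((g \<circ> h) s)) ` U) \<subseteq> \<pi> ` S" using interior_subset by (rule order_trans[rotated])
    ultimately show "\<exists>W. open W \<and> w \<in> W \<and> W \<subseteq> \<pi> ` S"
      by (intro exI[of _ "interior ((\<lambda>s. \<pi> ((g \<circ> h) s)) ` U)"]) simp
  qed
  \<comment> \<open>A projection need not preserve closedness. On the plane it is inverse to the
    continuous section with first entry c, so the image is a preimage of the closed set S.\<close>
  have \<pi>S: "\<pi> ` S = (\<lambda>w::real^2. vector [c, w$1, w$2]) -` S"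
  proof -
    have 1: "x = vector [c, \<pi> x $ 1, \<pi> x $ 2]" if "x \<in> S" for x
      using that flat by (auto simp: S_def \<pi>_def vec_eq_iff forall_3)
    have 2: "\<pi> (vector [c, w$1, w$2]) = w" for w
      by (simp add: \<pi>_def vec_eq_iff forall_2)
    show ?thesis
    proof (intro set_eqI iffI)
      fix w assume "w \<in> \<pi> ` S"
      then obtain x where "x \<in> S" "w = \<pi> x" by blast
      then show "w \<in> (\<lambda>w. vector [c, w$1, w$2]) -` S" using 1[of x] by simp
    next
      fix w assume "w \<in> (\<lambda>w::real^2. vector [c, w$1, w$2]) -` S"
      then have "\<pi> (vector [c, w$1, w$2]) \<in> \<pi> ` S" by blast
      then show "w \<in> \<pi> ` S" unfolding 2 .
    qed
  qed
  have cl: "closed (\<pi> ` S)"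
    unfolding \<pi>S
  proof (rule closed_vimage[OF closed])
    have eq: "vector [r, s, t] = r *\<^sub>R axis 1 1 + s *\<^sub>R axis 2 1 + t *\<^sub>R (axis 3 1 :: real^3)" for r s t :: real
      by (simp add: vec_eq_iff forall_3 axis_def)
    show "continuous_on UNIV (\<lambda>w::real^2. vector [c, w$1, w$2] :: real^3)"
      unfolding eq
      by (intro continuous_on_add continuous_on_scaleR continuous_on_const continuous_on_component continuous_on_id)
  qed
  have "\<pi> ` S \<noteq> {}" using ne by (simp add: S_def)
  then have all: "\<pi> ` S = UNIV" using clopen[of "\<pi> ` S"] op cl by simp
  have "x \<in> S" if "x$1 = c" for x
  proof -
    have "\<pi> x \<in> (\<lambda>w::real^2. vector [c, w$1, w$2]) -` S" unfolding \<pi>S[symmetric] all by (rule UNIV_I)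
    moreover have "vector [c, \<pi> x $ 1, \<pi> x $ 2] = x" using that by (simp add: \<pi>_def vec_eq_iff forall_3)
    ultimately show ?thesis by simp
  qed
  moreover have "x$1 = c" if "x \<in> S" for x using that flat by (auto simp: S_def)
  ultimately have "S = {x. x$1 = c}" by blast
  then show ?thesis unfolding S_def by blast
qed

text \<open>Normalising the normal vector and rotating makes the linear form n times the first
  coordinate, which reduces the claim to \<open>halfspace_first_coordinate\<close>.\<close>

lemma vertical_halfspace:
  assumes surf: "properly_immersed_minimal_surface M f" and a: "(a1, a2) \<noteq> (0, 0)"
    and b: "\<And>q. q \<in> topspace M \<Longrightarrow> b \<le> a1 * f q $ 1 + a2 * f q $ 2"
  shows "\<exists>c. f ` topspace M = vertical_plane a1 a2 c"
proof -
  define n where "n = sqrt (a1 * a1 + a2 * a2)"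
  have n2: "a1 * a1 + a2 * a2 > 0" using a by (auto simp: sum_squares_gt_zero_iff)
  then have n: "n > 0" "n * n = a1 * a1 + a2 * a2" by (auto simp: n_def)
  define s t where "s = a1 / n" and "t = a2 / n"
  have st: "s * s + t * t = 1"
  proof -
    have "s * s + t * t = (a1 * a1 + a2 * a2) / (n * n)" by (simp add: s_def t_def add_divide_distrib)
    then show ?thesis unfolding n(2)[symmetric] using n(1) by simp
  qed
  let ?R = "nil_rot s t"
  have R1: "?R x $ 1 = (a1 * x$1 + a2 * x$2) / n" for x
    by (simp add: nil_rot_def s_def t_def add_divide_distrib)
  have inv: "nil_rot s (- t) (?R x) = x" for x
  proof -
    have "s * (s * x$1 + t * x$2) - t * (- t * x$1 + s * x$2) = (s * s + t * t) * x$1"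
      "t * (s * x$1 + t * x$2) + s * (- t * x$1 + s * x$2) = (s * s + t * t) * x$2"
      by (simp_all add: algebra_simps)
    then show ?thesis using st by (simp add: nil_rot_def vec_eq_iff forall_3)
  qed
  have inv': "?R (nil_rot s (- t) x) = x" for x
  proof -
    have "s * (s * x$1 - t * x$2) + t * (t * x$1 + s * x$2) = (s * s + t * t) * x$1"
      "- t * (s * x$1 - t * x$2) + s * (t * x$1 + s * x$2) = (s * s + t * t) * x$2"
      by (simp_all add: algebra_simps)
    then show ?thesis using st by (simp add: nil_rot_def vec_eq_iff forall_3)
  qed
  have Rc: "continuous_on A (nil_rot s r)" for A r
    using linear_nil_rot linear_continuous_on linear_conv_bounded_linear by blast
  note S = surf[unfolded properly_immersed_minimal_surface_def]
  have "\<exists>c. (?R \<circ> f) ` topspace M = {x. x$1 = c}"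
  proof (rule halfspace_first_coordinate)
    show "topspace M \<noteq> {}" "connected_space M" using S by auto
    show "continuous_map M euclidean (?R \<circ> f)"
      using S Rc[of UNIV] by (intro continuous_map_compose[of M euclidean]) auto
    show "compactin M {p \<in> topspace M. (?R \<circ> f) p \<in> K}" if "compact K" for K
    proof -
      have "compact (nil_rot s (- t) ` K)" using that Rc by (intro compact_continuous_image)
      then have "compactin M {p \<in> topspace M. f p \<in> nil_rot s (- t) ` K}" using S by blast
      \<comment> \<open>Properness transfers because rotating the surface amounts to rotating the
        compact set back.\<close>
      moreover have "f p \<in> nil_rot s (- t) ` K \<longleftrightarrow> (?R \<circ> f) p \<in> K" for p
        by (auto simp: inv' intro!: image_eqI[of "f p" _ "?R (f p)"] inv[symmetric])
      ultimately show ?thesis by simp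
    qed
    show "\<exists>U V h Y Z. openin M V \<and> q \<in> V \<and> homeomorphic_map (subtopology euclidean U) (subtopology M V) h
        \<and> minimal_jet U ((?R \<circ> f) \<circ> h) Y Z" if q: "q \<in> topspace M" for q
    proof -
      obtain U V h where u: "openin M V" "q \<in> V" "homeomorphic_map (subtopology euclidean U) (subtopology M V) h"
        "minimal_on U (f \<circ> h)" using S q by metis
      have "minimal_jet U (\<lambda>p. ?R ((f \<circ> h) p)) (\<lambda>a p. ?R (pder a (f \<circ> h) p)) (\<lambda>a b p. ?R (pder b (pder a (f \<circ> h)) p))"
        by (rule minimal_jet_rot[OF minimal_on_imp_jet[OF u(4)] st])
      moreover have "(\<lambda>p. ?R ((f \<circ> h) p)) = (?R \<circ> f) \<circ> h" by auto
      ultimately show ?thesis using u by metis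
    qed
    show "b / n \<le> (?R \<circ> f) q $ 1" if "q \<in> topspace M" for q
      using b[OF that] n by (simp add: R1 divide_right_mono)
  qed
  then obtain c where c: "?R ` f ` topspace M = {x. x$1 = c}" by (auto simp: image_comp)
  have "f ` topspace M = vertical_plane a1 a2 (c * n)"
  proof (intro set_eqI iffI)
    fix x assume "x \<in> f ` topspace M"
    then have "?R x $ 1 = c" using c by blast
    then show "x \<in> vertical_plane a1 a2 (c * n)" using n by (simp add: R1 vertical_plane_def field_simps)
  next
    fix x assume "x \<in> vertical_plane a1 a2 (c * n)"
    then have "?R x $ 1 = c" using n by (simp add: R1 vertical_plane_def)
    then have "?R x \<in> ?R ` f ` topspace M" using c by blast
    then show "x \<in> f ` topspace M" using inv by (metis imageE)
  qed
  then show ?thesis by blast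
qed

theorem theorem6p3:
  fixes M :: "'a topology" and f :: "'a \<Rightarrow> real^3" and a1 a2 b :: real
  assumes "properly_immersed_minimal_surface M f"
    and "(a1, a2) \<noteq> (0, 0)"
    and "f ` topspace M \<subseteq> {x. a1 * x$1 + a2 * x$2 \<le> b}
         \<or> f ` topspace M \<subseteq> {x. a1 * x$1 + a2 * x$2 \<ge> b}"
  shows "\<exists>c. f ` topspace M = vertical_plane a1 a2 c"
  using assms(3)
proof
  assume "f ` topspace M \<subseteq> {x. a1 * x$1 + a2 * x$2 \<ge> b}"
  then show ?thesis using vertical_halfspace[OF assms(1,2), of b] by auto
next
  assume "f ` topspace M \<subseteq> {x. a1 * x$1 + a2 * x$2 \<le> b}"
  \<comment> \<open>Reversing the normal exchanges the two sides, and the plane obtained has the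
    same family of parallels.\<close>
  then have "- b \<le> - a1 * f q $ 1 + - a2 * f q $ 2" if "q \<in> topspace M" for q
    using that by (auto simp: image_subset_iff)
  then obtain c where "f ` topspace M = vertical_plane (- a1) (- a2) c"
    using vertical_halfspace[OF assms(1), of "- a1" "- a2" "- b"] assms(2) by auto
  moreover have "vertical_plane (- a1) (- a2) c = vertical_plane a1 a2 (- c)"
    by (auto simp: vertical_plane_def)
  ultimately show ?thesis by blast
qed

end
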